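(* Let $\Gamma=(G,\sigma)$ be a signed graph with $G=(V,E)$, $E\ne\emptyset$, $n=|V|$, and potential $\kappa=0$. For any $p\ge1$ and any $k\in\{1,\dots,n\}$, the $k$-th variational eigenvalue $\lambda_k(\Delta_p^\sigma)$ satisfies $$\frac{2^{p-1}}{C^{p-1}p^p}(h_m^\sigma)^p\le\lambda_k(\Delta_p^\sigma)\le2^{p-1}h_k^\sigma,$$ where $C:=\max_{x\in V}\frac{\sum_{y\sim x}w_{xy}}{\mu_x}$ and $m$ is the number of strong nodal domains of an (arbitrary) eigenfunction of $\Delta_p^\sigma$ corresponding to $\lambda_k(\Delta_p^\sigma)$.
   Context: Setting. $G=(V,E)$ is a finite simple undirected graph, $n=|V|$, with edge measure $w:E\to(0,\infty)$, vertex weight $\mu:V\to(0,\infty)$ and signature $\sigma:E\to\{-1,1\}$ (potential $\kappa=0$). Values are written $w_{xy},\sigma_{xy},\mu_x$, and $x\sim y$ means $\{x,y\}\in E$. Put $\Phi_p(t)=|t|^{p-2}t$ for $t\neq0$ and $\Phi_p(0)=0$. Eigenpairs. For $p>1$, $\Delta_p^\sigma f(x)=\sum_{y\sim x}w_{xy}\Phi_p(f(x)-\sigma_{xy}f(y))$, and a nonzero $f:V\to\mathbb R$ is an eigenfunction with eigenvalue $\lambda\in\mathbb R$ if $\Delta_p^\sigma f(x)=\lambda\mu_x\Phi_p(f(x))$ for all $x\in V$. For $p=1$, let $\mathrm{Sgn}(t)=\{1\}$ if $t>0$, $[-1,1]$ if $t=0$, $\{-1\}$ if $t<0$; a nonzero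 $f:V\to\mathbb R$ is an eigenfunction of $\Delta_1^\sigma$ with eigenvalue $\lambda$ if there are numbers $z_{xy}\in\mathrm{Sgn}(f(x)-\sigma_{xy}f(y))$ (for all ordered pairs $x\sim y$) with $z_{xy}=-\sigma_{xy}z_{yx}$, and $z_x'\in\mathrm{Sgn}(f(x))$, such that $\sum_{y\sim x}w_{xy}z_{xy}=\lambda\mu_xz'_x$ for all $x\in V$. Variational eigenvalues. $\mathcal S_p=\{f\in\mathbb R^V:\sum_x\mu_x|f(x)|^p=1\}$. For a compact set $S=-S$ its index (Krasnoselskii genus) $\gamma(S)$ is $0$ if $S=\emptyset$, otherwise the least positive integer $k$ for which an odd continuous map $S\to\mathbb R^k\setminus\{0\}$ exists ($\infty$ if none). $\mathcal F_k(\mathcal S_p)$ is the family of compact $A=-A\subset\mathcal S_p$ with $\gamma(A)\ge k$. With $\mathcal R_p^\sigma(f)=\frac{\sum_{\{x,y\}\in E}w_{xy}|f(x)-\sigma_{xy}f(y)|^p}{\sum_{x\in V}\mu_x|f(x)|^p}$, set $\lambda_k(\Delta_p^\sigma)=\inf_{S\in\mathcal F_k(\mathcal S_p)}\sup_{f\in S}\mathcal R_p^\sigma(f)$. Strong nodal domains. A sequence $x_1,\dots,x_m$ of vertices is a strong nodal domain walk of $f$ if $x_i\sim x_{i+1}$ and $f(x_i)\sigma_{x_ix_{i+1}}f(x_{i+1})>0$ for all $i<m$. The number of strong nodal domains of $f$ is the number of classes of the equivalence relation on $\{x:f(x)\ne0\}$: $x=y$ or a strong nodal domain walk connects $x$ and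 $y$. Signed Cheeger constants. For $V_1,V_2\subset V$: $|E^{\pm}(V_1,V_2)|=\sum_{x\in V_1}\sum_{y\in V_2,\,y\sim x,\,\sigma_{xy}=\pm1}w_{xy}$, $|E^\pm(V_1)|=|E^\pm(V_1,V_1)|$, $|\partial V_1|=\sum_{x\in V_1}\sum_{y\notin V_1,\,y\sim x}w_{xy}$, $\mathrm{vol}_\mu(V_1)=\sum_{x\in V_1}\mu_x$. For disjoint $V_1,V_2$ with nonempty union, $\beta^\sigma(V_1,V_2)=\frac{2|E^+(V_1,V_2)|+|E^-(V_1)|+|E^-(V_2)|+|\partial(V_1\cup V_2)|}{\mathrm{vol}_\mu(V_1\cup V_2)}$. Then $h_k^\sigma=\min\max_{i=1,\dots,k}\beta^\sigma(V_{2i-1},V_{2i})$, the minimum over all families $\{(V_{2i-1},V_{2i})\}_{i=1}^k$ with $V_{2i-1}\cap V_{2i}=\emptyset$, $V_{2i-1}\cup V_{2i}\neq\emptyset$, and $(V_{2i-1}\cup V_{2i})\cap(V_{2j-1}\cup V_{2j})=\emptyset$ for $i\ne j$ ($1\le k\le n$). *)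

theory Defs
  imports "HOL-Analysis.Analysis" "HOL-Library.Extended_Nat"
begin

text \<open>
  The vertex set is the universe of a finite type \<open>'v\<close>, so \<open>n = CARD('v)\<close>. Edges are two-element
  sets of vertices, and \<open>w\<close> and \<open>\<sigma>\<close> are functions of the (unordered) edge; their values outside
  \<open>E\<close> are irrelevant.
\<close>

locale signed_graph =
  fixes E :: "'v::finite set set"
    and w :: "'v set \<Rightarrow> real"
    and \<sigma> :: "'v set \<Rightarrow> real"
    and \<mu> :: "'v \<Rightarrow> real"
  assumes edge_card: "e \<in> E \<Longrightarrow> card e = 2"
    and weight_pos: "e \<in> E \<Longrightarrow> w e > 0"
    and signature: "e \<in> E \<Longrightarrow> \<sigma> e \<in> {-1, 1}"
    and vertex_weight_pos: "\<mu> x > 0"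

definition neighbours :: "'v set set \<Rightarrow> 'v \<Rightarrow> 'v set" where
  "neighbours E x = {y. {x, y} \<in> E}"


subsection \<open>Eigenpairs\<close>

definition Phi :: "real \<Rightarrow> real \<Rightarrow> real" where
  "Phi p t = (if t = 0 then 0 else \<bar>t\<bar> powr (p - 2) * t)"

definition signed_p_laplacian ::
  "'v::finite set set \<Rightarrow> ('v set \<Rightarrow> real) \<Rightarrow> ('v set \<Rightarrow> real) \<Rightarrow> real \<Rightarrow> real ^ 'v \<Rightarrow> 'v \<Rightarrow> real" where
  "signed_p_laplacian E w \<sigma> p f x =
     (\<Sum>y\<in>neighbours E x. w {x, y} * Phi p (f $ x - \<sigma> {x, y} * f $ y))"

definition Sgn :: "real \<Rightarrow> real set" where
  "Sgn t = (if t > 0 then {1} else if t < 0 then {-1} else {-1..1})"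

definition is_eigenpair ::
  "'v::finite set set \<Rightarrow> ('v set \<Rightarrow> real) \<Rightarrow> ('v set \<Rightarrow> real) \<Rightarrow> ('v \<Rightarrow> real) \<Rightarrow> real
     \<Rightarrow> real ^ 'v \<Rightarrow> real \<Rightarrow> bool" where
  "is_eigenpair E w \<sigma> \<mu> p f lam \<longleftrightarrow>
     f \<noteq> 0 \<and>
     (if p = 1 then
        \<exists>z z'.
          (\<forall>x. \<forall>y\<in>neighbours E x.
             z x y \<in> Sgn (f $ x - \<sigma> {x, y} * f $ y) \<and> z x y = - \<sigma> {x, y} * z y x) \<and>
          (\<forall>x. z' x \<in> Sgn (f $ x)) \<and>
          (\<forall>x. (\<Sum>y\<in>neighbours E x. w {x, y} * z x y) = lam * \<mu> x * z' x)
      else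
        \<forall>x. signed_p_laplacian E w \<sigma> p f x = lam * \<mu> x * Phi p (f $ x))"


subsection \<open>Variational eigenvalues\<close>

definition p_sphere :: "('v::finite \<Rightarrow> real) \<Rightarrow> real \<Rightarrow> (real ^ 'v) set" where
  "p_sphere \<mu> p = {f. (\<Sum>x\<in>UNIV. \<mu> x * \<bar>f $ x\<bar> powr p) = 1}"

text \<open>
  \<open>Euclidean_space k\<close> is \<open>\<real>\<^sup>k\<close>, carried by the functions \<open>nat \<Rightarrow> real\<close> that vanish at all indices
  \<open>\<ge> k\<close>. The infimum is taken in \<^typ>\<open>enat\<close>, so the genus is \<open>\<infinity>\<close> if there is no admissible \<open>k\<close>.
\<close>

definition genus :: "(real ^ 'v::finite) set \<Rightarrow> enat" where
  "genus S =
     (if S = {} then 0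
      else INF k\<in>{k. k > 0 \<and>
             (\<exists>g. continuous_map (top_of_set S)
                    (subtopology (Euclidean_space k) (- {\<lambda>i. 0})) g \<and>
                  (\<forall>f\<in>S. \<forall>i. g (- f) i = - g f i))}. enat k)"

definition genus_family :: "nat \<Rightarrow> (real ^ 'v::finite) set \<Rightarrow> (real ^ 'v) set set" where
  "genus_family k X = {A. compact A \<and> uminus ` A = A \<and> A \<subseteq> X \<and> genus A \<ge> enat k}"

text \<open>
  The numerator runs over ordered pairs, in which every edge occurs twice; both occurrences
  contribute the same because \<open>\<bar>s - \<sigma> * t\<bar> = \<bar>t - \<sigma> * s\<bar>\<close> for \<open>\<sigma> = \<plusminus>1\<close>.
\<close>

definition rayleigh ::
  "'v::finite set set \<Rightarrow> ('v set \<Rightarrow> real) \<Rightarrow> ('v set \<Rightarrow> real) \<Rightarrow> ('v \<Rightarrow> real) \<Rightarrow> real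
     \<Rightarrow> real ^ 'v \<Rightarrow> real" where
  "rayleigh E w \<sigma> \<mu> p f =
     (1 / 2 * (\<Sum>x\<in>UNIV. \<Sum>y\<in>neighbours E x.
                 w {x, y} * \<bar>f $ x - \<sigma> {x, y} * f $ y\<bar> powr p)) /
     (\<Sum>x\<in>UNIV. \<mu> x * \<bar>f $ x\<bar> powr p)"

text \<open>
  Infimum and supremum are those of the reals: for \<open>1 \<le> k \<le> CARD('v)\<close> the family is nonempty (it
  contains the whole sphere) and its members are nonempty compact sets, on which the nonnegative
  Rayleigh quotient is bounded.
\<close>

definition variational_eigenvalue ::
  "'v::finite set set \<Rightarrow> ('v set \<Rightarrow> real) \<Rightarrow> ('v set \<Rightarrow> real) \<Rightarrow> ('v \<Rightarrow> real) \<Rightarrow> real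
     \<Rightarrow> nat \<Rightarrow> real" where
  "variational_eigenvalue E w \<sigma> \<mu> p k =
     (INF S\<in>genus_family k (p_sphere \<mu> p). SUP f\<in>S. rayleigh E w \<sigma> \<mu> p f)"


subsection \<open>Strong nodal domains\<close>

definition strong_nodal_walk ::
  "'v::finite set set \<Rightarrow> ('v set \<Rightarrow> real) \<Rightarrow> real ^ 'v \<Rightarrow> 'v list \<Rightarrow> bool" where
  "strong_nodal_walk E \<sigma> f xs \<longleftrightarrow>
     xs \<noteq> [] \<and>
     (\<forall>i. Suc i < length xs \<longrightarrow>
        {xs ! i, xs ! Suc i} \<in> E \<and>
        f $ (xs ! i) * \<sigma> {xs ! i, xs ! Suc i} * f $ (xs ! Suc i) > 0)"

definition strong_nodal_rel ::
  "'v::finite set set \<Rightarrow> ('v set \<Rightarrow> real) \<Rightarrow> real ^ 'v \<Rightarrow> ('v \<times> 'v) set" where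
  "strong_nodal_rel E \<sigma> f =
     {(x, y). f $ x \<noteq> 0 \<and> f $ y \<noteq> 0 \<and>
        (x = y \<or> (\<exists>xs. strong_nodal_walk E \<sigma> f xs \<and> hd xs = x \<and> last xs = y))}"

definition num_strong_nodal_domains ::
  "'v::finite set set \<Rightarrow> ('v set \<Rightarrow> real) \<Rightarrow> real ^ 'v \<Rightarrow> nat" where
  "num_strong_nodal_domains E \<sigma> f = card ({x. f $ x \<noteq> 0} // strong_nodal_rel E \<sigma> f)"


subsection \<open>Signed Cheeger constants\<close>

text \<open>\<open>signed_cut E w \<sigma> s A B\<close> is \<open>\<bar>E\<^sup>+(A, B)\<bar>\<close> for \<open>s = 1\<close> and \<open>\<bar>E\<^sup>-(A, B)\<bar>\<close> for \<open>s = -1\<close>.\<close>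

definition signed_cut ::
  "'v::finite set set \<Rightarrow> ('v set \<Rightarrow> real) \<Rightarrow> ('v set \<Rightarrow> real) \<Rightarrow> real \<Rightarrow> 'v set \<Rightarrow> 'v set \<Rightarrow> real" where
  "signed_cut E w \<sigma> s A B =
     (\<Sum>x\<in>A. \<Sum>y\<in>{y \<in> B. y \<in> neighbours E x \<and> \<sigma> {x, y} = s}. w {x, y})"

definition boundary_weight :: "'v::finite set set \<Rightarrow> ('v set \<Rightarrow> real) \<Rightarrow> 'v set \<Rightarrow> real" where
  "boundary_weight E w A = (\<Sum>x\<in>A. \<Sum>y\<in>neighbours E x - A. w {x, y})"

definition cheeger_beta ::
  "'v::finite set set \<Rightarrow> ('v set \<Rightarrow> real) \<Rightarrow> ('v set \<Rightarrow> real) \<Rightarrow> ('v \<Rightarrow> real)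
     \<Rightarrow> 'v set \<Rightarrow> 'v set \<Rightarrow> real" where
  "cheeger_beta E w \<sigma> \<mu> A B =
     (2 * signed_cut E w \<sigma> 1 A B + signed_cut E w \<sigma> (-1) A A + signed_cut E w \<sigma> (-1) B B
        + boundary_weight E w (A \<union> B)) / (\<Sum>x\<in>A \<union> B. \<mu> x)"

definition admissible_family :: "nat \<Rightarrow> (nat \<Rightarrow> 'v set) \<Rightarrow> bool" where
  "admissible_family k V \<longleftrightarrow>
     (\<forall>i\<in>{1..k}. V (2 * i - 1) \<inter> V (2 * i) = {} \<and> V (2 * i - 1) \<union> V (2 * i) \<noteq> {}) \<and>
     (\<forall>i\<in>{1..k}. \<forall>j\<in>{1..k}. i \<noteq> j \<longrightarrow>
        (V (2 * i - 1) \<union> V (2 * i)) \<inter> (V (2 * j - 1) \<union> V (2 * j)) = {})"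

text \<open>
  The minimum is over a finite set of values, since only finitely many pairs of vertex sets exist;
  that set is nonempty for \<open>1 \<le> k \<le> CARD('v)\<close>.
\<close>

definition cheeger_const ::
  "'v::finite set set \<Rightarrow> ('v set \<Rightarrow> real) \<Rightarrow> ('v set \<Rightarrow> real) \<Rightarrow> ('v \<Rightarrow> real) \<Rightarrow> nat \<Rightarrow> real" where
  "cheeger_const E w \<sigma> \<mu> k =
     Min {Max ((\<lambda>i. cheeger_beta E w \<sigma> \<mu> (V (2 * i - 1)) (V (2 * i))) ` {1..k}) | V.
            admissible_family k V}"

definition max_degree_ratio ::
  "'v::finite set set \<Rightarrow> ('v set \<Rightarrow> real) \<Rightarrow> ('v \<Rightarrow> real) \<Rightarrow> real" where
  "max_degree_ratio E w \<mu> = Max (range (\<lambda>x. (\<Sum>y\<in>neighbours E x. w {x, y}) / \<mu> x))"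

end

theory Submission
  imports Defs "HOL-Homology.Simplices"
begin

text \<open>
  \<^bold>\<open>The upper bound.\<close> Take \<open>k\<close> disjoint pairs of vertex sets that attain the Cheeger constant, and the
  functions that are \<open>1\<close> on the first and \<open>-1\<close> on the second set of a pair. On their linear span the
  Rayleigh quotient is at most \<open>2\<^bsup>p-1\<^esup>\<close> times the Cheeger constant: inside a pair only frustrated edges
  have energy, and the energy of any edge is at most \<open>2\<^bsup>p-1\<^esup>(\<bar>f x\<bar>\<^sup>p + \<bar>f y\<bar>\<^sup>p)\<close> by convexity
  (\<open>rayleigh_block_functions_le\<close>). The sphere of this \<open>k\<close>-dimensional space has genus at least \<open>k\<close>
  (\<open>block_sphere_in_genus_family\<close>), so it competes in the definition of the variational eigenvalue.

  That the genus is at least \<open>k\<close> is the Borsuk--Ulam theorem: there is no odd map from punctured \<open>k\<close>-space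
  to punctured \<open>j\<close>-space if \<open>j < k\<close> (\<open>Borsuk_Ulam\<close>). It is proved here with singular chains. There are
  chains \<open>c 0, \<dots>, c (k - 1)\<close>, the hemispheres of the cross-polytope, such that the boundary of \<open>c (p + 1)\<close>
  is \<open>c p\<close> plus or minus its antipode. If \<open>s 0, s 1, \<dots>\<close> are arbitrary functions with values 0 and 1 that
  the antipodal map exchanges, the cup product of the first \<open>p\<close> coboundaries \<open>\<delta>(s i)\<close> has an odd value on
  \<open>c p\<close> (\<open>odd_cochain_eval_equivariant_chains\<close>), and subdividing the chains changes nothing. For an odd map
  into punctured \<open>j\<close>-space let \<open>s i\<close> be the sign of its \<open>i\<close>-th coordinate: on a small enough simplex of
  dimension \<open>j\<close> one of these signs is constant, the product vanishes, and this is a contradiction.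

  \<^bold>\<open>The lower bound.\<close> Let \<open>f\<close> be an eigenfunction. Restricted to one of its nodal domains it
  has Rayleigh quotient at most the eigenvalue (\<open>signed_difference_energy_le\<close>). A function \<open>g\<close> of small
  Rayleigh quotient has a superlevel set, split by the sign of \<open>g\<close>, of small Cheeger quotient: integrating
  the frustration over the levels of \<open>\<bar>g\<bar>\<^sup>p\<close> gives the sum over the edges of \<open>\<bar>\<psi>(g x) - \<psi>(\<sigma> g y)\<bar>\<close> with
  \<open>\<psi> t = sgn t * \<bar>t\<bar> powr p\<close> (\<open>coarea_inequality\<close>), and this is compared with the energy by Amghibech's
  inequality (\<open>layer_gap_le\<close>) and Hoelder's inequality; here the constants \<open>p\<^sup>p\<close> and the powers of the
  maximal degree ratio and of 2 arise (\<open>cheeger_inequality_of_energy\<close>). One such pair in each nodal domain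
  makes a family of disjoint pairs, one for each domain.
\<close>

section \<open>Cochains on singular simplices\<close>

text \<open>
  The value of an integral cochain on a chain. Passing through the free group on one generator makes
  linearity in the chain a consequence of the rules for \<open>frag_extend\<close>.
\<close>

definition cochain_eval :: "('b \<Rightarrow> int) \<Rightarrow> ('b \<Rightarrow>\<^sub>0 int) \<Rightarrow> int" where
  "cochain_eval \<phi> c = Poly_Mapping.lookup (frag_extend (\<lambda>\<tau>. frag_cmul (\<phi> \<tau>) (frag_of ())) c) ()"

lemma cochain_eval_0 [simp]: "cochain_eval \<phi> 0 = 0"
  by (simp add: cochain_eval_def)

lemma cochain_eval_of [simp]: "cochain_eval \<phi> (frag_of \<tau>) = \<phi> \<tau>"
  by (simp add: cochain_eval_def)

lemma cochain_eval_add: "cochain_eval \<phi> (a + b) = cochain_eval \<phi> a + cochain_eval \<phi> b"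
  by (simp add: cochain_eval_def frag_extend_add lookup_add)

lemma cochain_eval_diff: "cochain_eval \<phi> (a - b) = cochain_eval \<phi> a - cochain_eval \<phi> b"
  by (simp add: cochain_eval_def frag_extend_diff lookup_minus)

lemma cochain_eval_cmul: "cochain_eval \<phi> (frag_cmul k c) = k * cochain_eval \<phi> c"
  by (simp add: cochain_eval_def frag_extend_cmul)

lemma cochain_eval_sum:
  "finite I \<Longrightarrow> cochain_eval \<phi> (sum c I) = (\<Sum>i\<in>I. cochain_eval \<phi> (c i))"
  by (induction I rule: finite_induct) (auto simp: cochain_eval_add)

lemma cochain_eval_eq:
  assumes "\<And>\<tau>. \<tau> \<in> Poly_Mapping.keys c \<Longrightarrow> \<phi> \<tau> = \<psi> \<tau>"
  shows "cochain_eval \<phi> c = cochain_eval \<psi> c"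
  unfolding cochain_eval_def using frag_extend_eq[of c] assms by (metis (no_types, lifting))

lemma cochain_eval_combine:
  "cochain_eval (\<lambda>\<tau>. a * \<phi> \<tau> + b * \<psi> \<tau>) c = a * cochain_eval \<phi> c + b * cochain_eval \<psi> c"
  using subset_UNIV
  by (induction c rule: frag_induction) (auto simp: cochain_eval_diff algebra_simps)

lemma cochain_eval_scale: "cochain_eval (\<lambda>\<tau>. a * \<phi> \<tau>) c = a * cochain_eval \<phi> c"
  using cochain_eval_combine[of a \<phi> 0 \<phi> c] by simp

definition vertex :: "((nat \<Rightarrow> real) \<Rightarrow> 'a) \<Rightarrow> nat \<Rightarrow> 'a" where
  "vertex \<tau> m = \<tau> (\<lambda>j. if j = m then 1 else 0)"

lemma vertex_singular_face:
  assumes "k \<le> Suc p" "m \<le> p"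
  shows "vertex (singular_face (Suc p) k \<tau>) m = vertex \<tau> (if m < k then m else Suc m)"
proof -
  have "simplical_face k (\<lambda>j. if j = m then 1 else 0 :: real)
      = (\<lambda>j. if j = (if m < k then m else Suc m) then 1 else 0)"
    by (auto simp: simplical_face_def fun_eq_iff)
  then show ?thesis
    using assms by (simp add: vertex_def singular_face_def)
qed

lemma vertex_simplex_map: "m \<le> p \<Longrightarrow> vertex (simplex_map p g \<tau>) m = g (vertex \<tau> m)"
  by (simp add: vertex_def simplex_map_def)

lemma vertex_in_topspace: "singular_simplex p X \<tau> \<Longrightarrow> m \<le> p \<Longrightarrow> vertex \<tau> m \<in> topspace X"
  by (force simp: singular_simplex_def vertex_def continuous_map_def Pi_iff)

text \<open>
  This is the cup product \<open>\<delta>s\<^sub>0 \<union> \<dots> \<union> \<delta>s\<^bsub>p-1\<^esub>\<close> of the coboundaries of \<open>p\<close> functions, evaluated on the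
  simplex with vertices \<open>v 0, \<dots>, v p\<close>. If the functions \<open>s i\<close> are odd up to a constant, each factor is
  modulo 2 a representative of the first Stiefel--Whitney class of the antipodal double cover; the
  freedom to take a different \<open>s i\<close> in each factor is what makes the product vanish on small simplices.
\<close>

definition cup_differences :: "(nat \<Rightarrow> 'a \<Rightarrow> int) \<Rightarrow> nat \<Rightarrow> (nat \<Rightarrow> 'a) \<Rightarrow> int" where
  "cup_differences s p v = (\<Prod>i<p. s i (v (Suc i)) - s i (v i))"

lemma cup_differences_cong:
  "(\<And>m. m \<le> p \<Longrightarrow> v m = u m) \<Longrightarrow> cup_differences s p v = cup_differences s p u"
  unfolding cup_differences_def by (intro prod.cong) auto

text \<open>
  The cocycle condition. In the induction the faces that omit one of the last two vertices combine,
  by telescoping of the last factor, to the term that cancels the remaining faces.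
\<close>

lemma cup_differences_closed:
  "(\<Sum>k\<le>Suc p. (-1) ^ k * cup_differences s p (\<lambda>m. v (if m < k then m else Suc m))) = 0"
proof (induction p)
  case 0
  then show ?case by (simp add: cup_differences_def)
next
  case (Suc p)
  let ?d = "\<lambda>k m. v (if m < k then m else Suc m)"
  have skip: "cup_differences s (Suc p) (?d k)
      = cup_differences s p (?d k) * (s p (v (Suc (Suc p))) - s p (v (Suc p)))" if "k \<le> p" for k
    using that by (auto simp: cup_differences_def)
  have head: "cup_differences s p (?d k) = cup_differences s p v" if "k \<ge> Suc p" for k
    using that by (intro cup_differences_cong) auto
  have step: "cup_differences s (Suc p) u = cup_differences s p u * (s p (u (Suc p)) - s p (u p))" for u
    by (simp add: cup_differences_def)
  have IH: "(\<Sum>k\<le>p. (-1) ^ k * cup_differences s p (?d k)) = (-1) ^ p * cup_differences s p v"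
    using Suc.IH head[of "Suc p"] by simp
  have "(\<Sum>k\<le>p. (-1) ^ k * cup_differences s (Suc p) (?d k))
      = (\<Sum>k\<le>p. (-1) ^ k * cup_differences s p (?d k)) * (s p (v (Suc (Suc p))) - s p (v (Suc p)))"
    unfolding sum_distrib_right by (intro sum.cong) (auto simp: skip mult.assoc)
  also have "\<dots> = (-1) ^ p * cup_differences s p v * (s p (v (Suc (Suc p))) - s p (v (Suc p)))"
    using IH by simp
  finally have low: "(\<Sum>k\<le>p. (-1) ^ k * cup_differences s (Suc p) (?d k))
      = (-1) ^ p * cup_differences s p v * (s p (v (Suc (Suc p))) - s p (v (Suc p)))" .
  have "(\<Sum>k\<le>Suc (Suc p). (-1) ^ k * cup_differences s (Suc p) (?d k))
     = (\<Sum>k\<le>p. (-1) ^ k * cup_differences s (Suc p) (?d k))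
       + (-1) ^ Suc p * cup_differences s (Suc p) (?d (Suc p))
       + (-1) ^ Suc (Suc p) * cup_differences s (Suc p) (?d (Suc (Suc p)))"
    by simp
  also have "cup_differences s (Suc p) (?d (Suc p))
      = cup_differences s p v * (s p (v (Suc (Suc p))) - s p (v p))"
    unfolding step head[OF order_refl] by simp
  also have "cup_differences s (Suc p) (?d (Suc (Suc p)))
      = cup_differences s p v * (s p (v (Suc p)) - s p (v p))"
    unfolding step head[OF le_SucI[OF order_refl]] by simp
  finally show ?case
    unfolding low by (simp add: algebra_simps)
qed

text \<open>
  The Leibniz rule \<open>\<delta>(W \<union> s\<^sub>p) = \<plusminus> W \<union> \<delta>s\<^sub>p\<close> for the cocycle \<open>W = \<delta>s\<^sub>0 \<union> \<dots> \<union> \<delta>s\<^bsub>p-1\<^esub>\<close>.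
\<close>

lemma coboundary_cup_differences:
  "(\<Sum>k\<le>Suc p. (-1) ^ k * (cup_differences s p (\<lambda>m. v (if m < k then m else Suc m))
                              * s p (v (if p < k then p else Suc p))))
   = (-1) ^ p * cup_differences s (Suc p) v"
proof -
  let ?d = "\<lambda>k m. v (if m < k then m else Suc m)"
  have head: "cup_differences s p (?d (Suc p)) = cup_differences s p v"
    by (intro cup_differences_cong) auto
  have "(\<Sum>k\<le>p. (-1) ^ k * (cup_differences s p (?d k) * s p (v (if p < k then p else Suc p))))
      = (\<Sum>k\<le>p. (-1) ^ k * cup_differences s p (?d k)) * s p (v (Suc p))"
    unfolding sum_distrib_right by (intro sum.cong) (auto simp: mult.assoc)
  also have "(\<Sum>k\<le>p. (-1) ^ k * cup_differences s p (?d k)) = (-1) ^ p * cup_differences s p v"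
    using cup_differences_closed[where s=s and p=p and v=v] head by simp
  finally show ?thesis
    by (simp add: head cup_differences_def algebra_simps)
qed

section \<open>The Borsuk--Ulam theorem\<close>

text \<open>
  Such chains play the role of the upper hemispheres of a sphere of dimension \<open>d\<close>: the boundary of each
  hemisphere is the sphere one dimension lower, made of the previous hemisphere and its antipode. The
  signs make the boundary of each boundary vanish.
\<close>

definition equivariant_chains ::
  "'a topology \<Rightarrow> ('a \<Rightarrow> 'a) \<Rightarrow> nat \<Rightarrow> (nat \<Rightarrow> 'a chain) \<Rightarrow> bool" where
  "equivariant_chains X a d c \<longleftrightarrow>
     continuous_map X X a \<and> (\<forall>p\<le>d. singular_chain p X (c p)) \<and> (\<exists>\<tau>. c 0 = frag_of \<tau>) \<and>
     (\<forall>p<d. chain_boundary (Suc p) (c (Suc p)) = c p + frag_cmul ((-1) ^ Suc p) (chain_map p a (c p)))"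

lemma cochain_eval_chain_boundary:
  assumes "singular_chain (Suc p) X c"
  shows "cochain_eval \<phi> (chain_boundary (Suc p) c)
       = cochain_eval (\<lambda>\<tau>. \<Sum>k\<le>Suc p. (-1) ^ k * \<phi> (singular_face (Suc p) k \<tau>)) c"
  using assms unfolding singular_chain_def
proof (induction c rule: frag_induction)
  case (one \<tau>)
  then show ?case
    by (simp add: chain_boundary_of cochain_eval_sum cochain_eval_cmul cochain_eval_add)
qed (auto simp: chain_boundary_diff cochain_eval_diff)

lemma cochain_eval_chain_map:
  "cochain_eval \<phi> (chain_map p g c) = cochain_eval (\<lambda>\<tau>. \<phi> (simplex_map p g \<tau>)) c"
  using subset_UNIV
  by (induction c rule: frag_induction) (auto simp: chain_map_diff cochain_eval_diff)

text \<open>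
  The invariant behind the Borsuk--Ulam theorem. Let \<open>W p\<close> be the product of the first \<open>p\<close> coboundaries
  and put \<open>\<phi> = W p \<union> s p\<close>. By the Leibniz rule \<open>W (p + 1)\<close> on \<open>c (p + 1)\<close> is, up to sign, \<open>\<phi>\<close> on the
  boundary of \<open>c (p + 1)\<close>, that is, on \<open>c p\<close> plus or minus its antipode. As \<open>s p\<close> turns into \<open>1 - s p\<close> under
  the antipodal map, the two contributions of \<open>\<phi>\<close> add up to \<open>W p\<close> on \<open>c p\<close> modulo 2. So the parity
  does not depend on \<open>p\<close>, and in dimension 0 the value is 1.
\<close>

lemma odd_cochain_eval_equivariant_chains:
  assumes c: "equivariant_chains X a d c"
    and s: "\<And>i x. x \<in> topspace X \<Longrightarrow> s i (a x) = 1 - s i x"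
    and "p \<le> d"
  shows "odd (cochain_eval (\<lambda>\<tau>. cup_differences s p (vertex \<tau>)) (c p))"
  using \<open>p \<le> d\<close>
proof (induction p)
  case 0
  from c obtain \<tau> where "c 0 = frag_of \<tau>" by (auto simp: equivariant_chains_def)
  then show ?case by (simp add: cup_differences_def)
next
  case (Suc p)
  define W where "W q \<tau> = cup_differences s q (vertex \<tau>)" for q and \<tau> :: "(nat \<Rightarrow> real) \<Rightarrow> 'a"
  define \<phi> where "\<phi> \<tau> = W p \<tau> * s p (vertex \<tau> p)" for \<tau> :: "(nat \<Rightarrow> real) \<Rightarrow> 'a"
  have cp: "singular_chain p X (c p)" and cSp: "singular_chain (Suc p) X (c (Suc p))"
    and bd: "chain_boundary (Suc p) (c (Suc p)) = c p + frag_cmul ((-1) ^ Suc p) (chain_map p a (c p))"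
    using c Suc.prems by (auto simp: equivariant_chains_def)
  have "(\<Sum>k\<le>Suc p. (-1) ^ k * \<phi> (singular_face (Suc p) k \<tau>)) = (-1) ^ p * W (Suc p) \<tau>" for \<tau>
  proof -
    have "\<phi> (singular_face (Suc p) k \<tau>)
        = cup_differences s p (\<lambda>m. vertex \<tau> (if m < k then m else Suc m))
            * s p (vertex \<tau> (if p < k then p else Suc p))" if "k \<le> Suc p" for k
    proof -
      have "cup_differences s p (vertex (singular_face (Suc p) k \<tau>))
          = cup_differences s p (\<lambda>m. vertex \<tau> (if m < k then m else Suc m))"
        using that by (intro cup_differences_cong vertex_singular_face)
      then show ?thesis
        using that by (simp add: \<phi>_def W_def vertex_singular_face)
    qed
    then have "(\<Sum>k\<le>Suc p. (-1) ^ k * \<phi> (singular_face (Suc p) k \<tau>))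
       = (\<Sum>k\<le>Suc p. (-1) ^ k * (cup_differences s p (\<lambda>m. vertex \<tau> (if m < k then m else Suc m))
                              * s p (vertex \<tau> (if p < k then p else Suc p))))"
      by (intro sum.cong) auto
    then show ?thesis
      by (simp only: coboundary_cup_differences W_def)
  qed
  then have "cochain_eval \<phi> (chain_boundary (Suc p) (c (Suc p)))
      = cochain_eval (\<lambda>\<tau>. (-1) ^ p * W (Suc p) \<tau>) (c (Suc p))"
    using cochain_eval_chain_boundary[OF cSp, of \<phi>] by simp
  then have lhs: "cochain_eval \<phi> (chain_boundary (Suc p) (c (Suc p)))
      = (-1) ^ p * cochain_eval (W (Suc p)) (c (Suc p))"
    by (simp only: cochain_eval_scale)
  have flip: "\<phi> (simplex_map p a \<tau>) = (-1) ^ p * W p \<tau> + (- ((-1) ^ p)) * \<phi> \<tau>"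
    if "\<tau> \<in> Poly_Mapping.keys (c p)" for \<tau>
  proof -
    have v: "vertex \<tau> m \<in> topspace X" if "m \<le> p" for m
      using cp that \<open>\<tau> \<in> _\<close> by (auto simp: singular_chain_def intro: vertex_in_topspace)
    have "cup_differences s p (vertex (simplex_map p a \<tau>))
        = (\<Prod>i<p. (- 1) * (s i (vertex \<tau> (Suc i)) - s i (vertex \<tau> i)))"
      unfolding cup_differences_def by (intro prod.cong) (auto simp: vertex_simplex_map s v)
    also have "\<dots> = (-1) ^ p * W p \<tau>"
      by (simp only: prod.distrib W_def cup_differences_def) simp
    finally show ?thesis
      by (simp add: \<phi>_def W_def vertex_simplex_map s v algebra_simps)
  qed
  have "cochain_eval \<phi> (chain_map p a (c p))
      = cochain_eval (\<lambda>\<tau>. (-1) ^ p * W p \<tau> + (- ((-1) ^ p)) * \<phi> \<tau>) (c p)"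
    unfolding cochain_eval_chain_map by (intro cochain_eval_eq flip)
  also have "\<dots> = (-1) ^ p * cochain_eval (W p) (c p) - (-1) ^ p * cochain_eval \<phi> (c p)"
    by (subst cochain_eval_combine) simp
  finally have "(-1) ^ p * cochain_eval (W (Suc p)) (c (Suc p))
      = 2 * cochain_eval \<phi> (c p) - cochain_eval (W p) (c p)"
    using lhs unfolding bd
    by (cases "even p") (simp_all add: cochain_eval_add cochain_eval_diff cochain_eval_cmul)
  moreover have "odd (cochain_eval (W p) (c p))"
    using Suc by (simp add: W_def[abs_def])
  ultimately have "odd ((-1) ^ p * cochain_eval (W (Suc p)) (c (Suc p)))"
    by simp
  then show ?case
    by (simp add: W_def[abs_def])
qed

lemma equivariant_chains_subdivision:
  assumes "equivariant_chains X a d c"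
  shows "equivariant_chains X a d (\<lambda>p. (singular_subdivision p ^^ n) (c p))"
proof (induction n)
  case 0
  then show ?case using assms by simp
next
  case (Suc n)
  define b where "b p = (singular_subdivision p ^^ n) (c p)" for p
  have b: "equivariant_chains X a d b" using Suc unfolding b_def .
  have cmul: "singular_subdivision p (frag_cmul k x) = frag_cmul k (singular_subdivision p x)"
    for p k and x :: "'a chain"
    by (simp add: singular_subdivision_def frag_extend_cmul)
  have "equivariant_chains X a d (\<lambda>p. singular_subdivision p (b p))"
    unfolding equivariant_chains_def
  proof (intro conjI allI impI)
    show "continuous_map X X a" using b by (simp add: equivariant_chains_def)
    show "singular_chain p X (singular_subdivision p (b p))" if "p \<le> d" for p
      using b that by (simp add: equivariant_chains_def singular_chain_singular_subdivision)
    have "singular_chain 0 X (b 0)" using b by (simp add: equivariant_chains_def)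
    then have "singular_subdivision 0 (b 0) = b 0" by (rule singular_subdivision_zero)
    then show "\<exists>\<tau>. singular_subdivision 0 (b 0) = frag_of \<tau>"
      using b by (simp add: equivariant_chains_def)
  next
    fix p assume "p < d"
    then have bp: "singular_chain p X (b p)" "singular_chain (Suc p) X (b (Suc p))"
      and bd: "chain_boundary (Suc p) (b (Suc p)) = b p + frag_cmul ((-1) ^ Suc p) (chain_map p a (b p))"
      using b by (auto simp: equivariant_chains_def)
    show "chain_boundary (Suc p) (singular_subdivision (Suc p) (b (Suc p)))
        = singular_subdivision p (b p)
          + frag_cmul ((-1) ^ Suc p) (chain_map p a (singular_subdivision p (b p)))"
      using chain_boundary_singular_subdivision[OF bp(2)]
      by (simp only: bd diff_Suc_Suc diff_zero singular_subdivision_add cmul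
          naturality_singular_subdivision[OF bp(1)])
  qed
  then show ?case by (simp add: b_def)
qed

abbreviation negate :: "(nat \<Rightarrow> real) \<Rightarrow> nat \<Rightarrow> real" where
  "negate x \<equiv> (\<lambda>i. - x i)"

definition punctured_space :: "nat \<Rightarrow> (nat \<Rightarrow> real) topology" where
  "punctured_space k = subtopology (Euclidean_space k) (- {\<lambda>i. 0})"

lemma topspace_punctured_space:
  "topspace (punctured_space k) = {x. (\<forall>i\<ge>k. x i = 0) \<and> (\<exists>i<k. x i \<noteq> 0)}"
  by (auto simp: punctured_space_def topspace_Euclidean_space fun_eq_iff) (meson not_le)

lemma punctured_space_eq:
  "punctured_space k = subtopology (powertop_real UNIV) {x. (\<forall>i\<ge>k. x i = 0) \<and> (\<exists>i<k. x i \<noteq> 0)}"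
  unfolding topspace_punctured_space[symmetric] 
  by (simp add: punctured_space_def Euclidean_space_def subtopology_subtopology)

lemma continuous_map_negate: "continuous_map (punctured_space k) (punctured_space k) negate"
  unfolding punctured_space_eq
  by (auto simp: continuous_map_in_subtopology continuous_map_componentwise
      intro!: continuous_intros continuous_map_from_subtopology continuous_map_product_projection)

text \<open>
  The upper hemisphere of the boundary of the cross-polytope: the cone, with the next unit vector as
  apex, over the equator.
\<close>

primrec cross_polytope_chain :: "nat \<Rightarrow> (nat \<Rightarrow> real) chain" where
  "cross_polytope_chain 0 = frag_of (oriented_simplex 0 (\<lambda>_ i. if i = 0 then 1 else 0))"
| "cross_polytope_chain (Suc p) =
     simplicial_cone p (\<lambda>i. if i = Suc p then 1 else 0)
       (cross_polytope_chain p + frag_cmul ((-1) ^ Suc p) (chain_map p negate (cross_polytope_chain p)))"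

lemma simplicial_chain_negate:
  assumes "simplicial_chain p S c" and "\<And>x. x \<in> S \<Longrightarrow> negate x \<in> S"
  shows "simplicial_chain p S (chain_map p negate c)"
  using assms(1) unfolding simplicial_chain_def
proof (induction rule: frag_induction)
  case (one f)
  then obtain l where f: "f ` standard_simplex p \<subseteq> S" "f = oriented_simplex p l"
    by (auto simp: simplicial_simplex)
  have "simplex_map p negate f = oriented_simplex p (\<lambda>j. negate (l j))"
    by (auto simp: simplex_map_def f(2) oriented_simplex_def sum_negf)
  moreover have "simplex_map p negate f ` standard_simplex p \<subseteq> S"
    using f(1) assms(2) by (auto simp: simplex_map_def)
  ultimately show ?case
    by (auto simp: simplicial_simplex)
next
  case (diff a b)
  then show ?case
    using simplicial_chain_diff[of p S "chain_map p negate a" "chain_map p negate b"]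
    by (simp add: chain_map_diff simplicial_chain_def)
qed auto

lemma simplicial_chain_add:
  "simplicial_chain p S a \<Longrightarrow> simplicial_chain p S b \<Longrightarrow> simplicial_chain p S (a + b)"
  unfolding simplicial_chain_def using keys_add[of a b] by blast

lemma simplicial_cross_polytope_chain:
  "simplicial_chain p (topspace (punctured_space (Suc p))) (cross_polytope_chain p)"
proof (induction p)
  case 0
  have "oriented_simplex 0 (\<lambda>_ i. if i = 0 then 1 else 0) ` standard_simplex 0
      \<subseteq> topspace (punctured_space (Suc 0))"
    by (auto simp: topspace_punctured_space standard_simplex_0 oriented_simplex_def)
  then show ?case
    by (auto simp: simplicial_simplex)
next
  case (Suc p)
  let ?b = "cross_polytope_chain p + frag_cmul ((-1) ^ Suc p) (chain_map p negate (cross_polytope_chain p))"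
  have b: "simplicial_chain p (topspace (punctured_space (Suc p))) ?b"
    by (intro simplicial_chain_add simplicial_chain_cmul simplicial_chain_negate Suc.IH)
      (auto simp: topspace_punctured_space)
  show ?case
    unfolding cross_polytope_chain.simps
  proof (rule simplicial_chain_simplicial_cone[OF b])
    fix x u assume u: "0 \<le> (u::real)" "u \<le> 1" and x: "x \<in> topspace (punctured_space (Suc p))"
    show "(\<lambda>i. (1 - u) * (if i = Suc p then 1 else 0) + u * x i) \<in> topspace (punctured_space (Suc (Suc p)))"
    proof (cases "u = 0")
      case True
      then show ?thesis by (auto simp: topspace_punctured_space)
    next
      case False
      then show ?thesis using x
        by (auto simp: topspace_punctured_space intro!: less_SucI)
          (metis less_SucI less_irrefl)
    qed
  qed
qed

lemma chain_map_negate_negate: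
  assumes "singular_chain p X c"
  shows "chain_map p negate (chain_map p negate c) = c"
proof -
  have "chain_map p (negate \<circ> negate) c = c"
    using assms by (rule chain_map_id_gen) auto
  then show ?thesis by (simp add: chain_map_compose)
qed

lemma singular_cross_polytope_chain:
  assumes "p < k" shows "singular_chain p (punctured_space k) (cross_polytope_chain p)"
proof -
  have "topspace (punctured_space (Suc p)) \<subseteq> topspace (punctured_space k)"
    using assms unfolding topspace_punctured_space
    by auto (meson Suc_leI less_le_trans)
  then have "simplicial_chain p (topspace (punctured_space k)) (cross_polytope_chain p)"
    using simplicial_cross_polytope_chain[of p] unfolding simplicial_chain_def simplicial_simplex
    by blast
  then have "singular_chain p (subtopology (powertop_real UNIV) (topspace (punctured_space k)))
      (cross_polytope_chain p)"
    by (rule simplicial_imp_singular_chain)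
  then show ?thesis
    by (simp only: topspace_punctured_space flip: punctured_space_eq)
qed

lemma chain_boundary_cross_polytope_chain:
  "chain_boundary (Suc p) (cross_polytope_chain (Suc p))
   = cross_polytope_chain p + frag_cmul ((-1) ^ Suc p) (chain_map p negate (cross_polytope_chain p))"
proof (induction p)
  case 0
  let ?S = "topspace (punctured_space 1)"
  let ?b = "cross_polytope_chain 0 + frag_cmul ((-1) ^ Suc 0) (chain_map 0 negate (cross_polytope_chain 0))"
  have b: "simplicial_chain 0 ?S ?b"
    using simplicial_cross_polytope_chain[of 0]
    by (intro simplicial_chain_add simplicial_chain_cmul simplicial_chain_negate)
      (auto simp: topspace_punctured_space)
  show ?case
    unfolding cross_polytope_chain.simps(2) chain_boundary_simplicial_cone[OF b]
    by (simp add: frag_extend_diff)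
next
  case (Suc p)
  let ?c = "cross_polytope_chain"
  let ?S = "topspace (punctured_space (Suc (Suc p)))"
  let ?b = "?c (Suc p) + frag_cmul ((-1) ^ Suc (Suc p)) (chain_map (Suc p) negate (?c (Suc p)))"
  have b: "simplicial_chain (Suc p) ?S ?b"
    using simplicial_cross_polytope_chain[of "Suc p"]
    by (intro simplicial_chain_add simplicial_chain_cmul simplicial_chain_negate)
      (auto simp: topspace_punctured_space)
  have sing: "singular_chain (Suc p) (punctured_space (Suc (Suc p))) (?c (Suc p))"
    "singular_chain p (punctured_space (Suc (Suc p))) (?c p)"
    by (simp_all only: singular_cross_polytope_chain lessI less_SucI)
  have "chain_boundary (Suc p) (chain_map (Suc p) negate (?c (Suc p)))
      = chain_map p negate (chain_boundary (Suc p) (?c (Suc p)))"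
    using chain_boundary_chain_map[OF sing(1)] by simp
  then have "chain_boundary (Suc p) ?b = 0"
    unfolding chain_boundary_add chain_boundary_cmul
    by (simp del: cross_polytope_chain.simps
        add: Suc.IH chain_map_add chain_map_minus chain_map_negate_negate[OF sing(2)] frag_cmul_distrib2)
      (simp flip: frag_cmul_distrib)
  then show ?case
    unfolding cross_polytope_chain.simps(2)[of "Suc p"] chain_boundary_simplicial_cone[OF b]
    by (simp del: cross_polytope_chain.simps add: simplicial_cone_def)
qed

lemma equivariant_cross_polytope_chain:
  assumes "d < k"
  shows "equivariant_chains (punctured_space k) negate d cross_polytope_chain"
  using assms unfolding equivariant_chains_def
  by (auto simp: continuous_map_negate chain_boundary_cross_polytope_chain
      intro: singular_cross_polytope_chain simp del: cross_polytope_chain.simps(2))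

text \<open>
  Suppose \<open>j < k\<close>. Let \<open>s i\<close> be the sign of the \<open>i\<close>-th coordinate of \<open>g\<close>. The product of the \<open>j\<close>
  coboundaries \<open>\<delta>(s i)\<close> has odd value on the \<open>j\<close>-dimensional hemisphere and on all its subdivisions. But
  \<open>g\<close> has no zero, so the sets where a given coordinate of \<open>g\<close> has a given sign form an open cover; once
  every simplex of the subdivision lies in a set of this cover, one factor of the product vanishes on it.
\<close>

theorem Borsuk_Ulam:
  assumes g: "continuous_map (punctured_space k) (punctured_space j) g"
    and odd: "\<And>x i. x \<in> topspace (punctured_space k) \<Longrightarrow> g (negate x) i = - g x i"
  shows "k \<le> j"
proof (rule ccontr)
  assume "\<not> k \<le> j"
  let ?X = "punctured_space k"
  have eq: "equivariant_chains ?X negate j cross_polytope_chain"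
    using \<open>\<not> k \<le> j\<close> by (intro equivariant_cross_polytope_chain) simp
  define U where "U i e = {x \<in> topspace ?X. e * g x i > 0}" for i and e :: real
  have opn: "openin ?X (U i e)" for i e
  proof -
    have "continuous_map ?X euclideanreal (\<lambda>x. g x i)"
      using g by (simp add: punctured_space_eq continuous_map_in_subtopology continuous_map_componentwise)
    then have "continuous_map ?X euclideanreal (\<lambda>x. e * g x i)"
      by (intro continuous_intros)
    then have "openin ?X {x \<in> topspace ?X. e * g x i \<in> {0<..}}"
      by (rule openin_continuous_map_preimage) (metis open_greaterThan open_openin)
    then show ?thesis by (simp add: U_def)
  qed
  let ?C = "(\<lambda>(i, e). U i e) ` ({..<j} \<times> {1, -1})"
  have cover: "topspace ?X \<subseteq> \<Union>?C"
  proof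
    fix x assume x: "x \<in> topspace ?X"
    then have "g x \<in> topspace (punctured_space j)"
      using g by (auto simp: continuous_map_def Pi_iff)
    then obtain i where "i < j" "g x i \<noteq> 0" by (auto simp: topspace_punctured_space)
    then have "x \<in> U i 1 \<or> x \<in> U i (-1)" using x by (auto simp: U_def)
    then obtain e where "e \<in> {1, -1}" "x \<in> U i e" by blast
    then show "x \<in> \<Union>?C" using \<open>i < j\<close> by blast
  qed
  obtain n where n: "\<And>\<tau>. \<tau> \<in> Poly_Mapping.keys ((singular_subdivision j ^^ n) (cross_polytope_chain j))
      \<Longrightarrow> \<exists>V\<in>?C. \<tau> \<in> standard_simplex j \<rightarrow> V"
  proof (rule sufficient_iterated_singular_subdivision_exists[of ?C ?X j "cross_polytope_chain j"])
    show "singular_chain j ?X (cross_polytope_chain j)"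
      using eq by (simp add: equivariant_chains_def)
  qed (use opn cover that in auto)
  \<comment> \<open>Where a coordinate of \<open>g\<close> is zero its sign is replaced by that of the first nonzero coordinate
    of \<open>x\<close>, so that \<open>s i\<close> is odd everywhere.\<close>
  define s where "s i x = (if g x i > 0 \<or> g x i = 0 \<and> x (LEAST m. x m \<noteq> 0) > 0 then 1 else 0 :: int)" for i x
  have flip: "s i (negate x) = 1 - s i x" if x: "x \<in> topspace ?X" for i x
  proof -
    have "\<exists>m. x m \<noteq> 0" using x by (auto simp: topspace_punctured_space)
    then have "x (LEAST m. x m \<noteq> 0) \<noteq> 0" by (rule LeastI_ex)
    then show ?thesis using odd[OF x] by (auto simp: s_def)
  qed
  have "cup_differences s j (vertex \<tau>) = 0"
    if \<tau>: "\<tau> \<in> Poly_Mapping.keys ((singular_subdivision j ^^ n) (cross_polytope_chain j))" for \<tau>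
  proof -
    obtain i e where ie: "i < j" "e = 1 \<or> e = -1" "\<tau> \<in> standard_simplex j \<rightarrow> U i e"
      using n[OF \<tau>] by auto
    have "vertex \<tau> m \<in> U i e" if "m \<le> j" for m
      using ie(3) that by (auto simp: vertex_def Pi_iff)
    from this[of i] this[of "Suc i"] have "s i (vertex \<tau> (Suc i)) - s i (vertex \<tau> i) = 0"
      using ie(1,2) by (auto simp: U_def s_def)
    then show ?thesis
      using ie(1) by (auto simp: cup_differences_def intro!: prod_zero)
  qed
  then have "cochain_eval (\<lambda>\<tau>. cup_differences s j (vertex \<tau>))
      ((singular_subdivision j ^^ n) (cross_polytope_chain j))
    = cochain_eval (\<lambda>\<tau>. 0 * 0) ((singular_subdivision j ^^ n) (cross_polytope_chain j))"
    by (intro cochain_eval_eq) simp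
  then have "cochain_eval (\<lambda>\<tau>. cup_differences s j (vertex \<tau>))
      ((singular_subdivision j ^^ n) (cross_polytope_chain j)) = 0"
    by (simp only: cochain_eval_scale)
  moreover have "odd (cochain_eval (\<lambda>\<tau>. cup_differences s j (vertex \<tau>))
      ((singular_subdivision j ^^ n) (cross_polytope_chain j)))"
    by (rule odd_cochain_eval_equivariant_chains[OF equivariant_chains_subdivision[OF eq] _ order_refl])
      (rule flip)
  ultimately show False by simp
qed

section \<open>The genus of a set with an odd map from a sphere\<close>

text \<open>
  Composing with \<open>h\<close> turns an odd map from \<open>S\<close> into punctured \<open>j\<close>-space into one that the
  Borsuk--Ulam theorem excludes unless \<open>k \<le> j\<close>.
\<close>

lemma genus_ge:
  fixes S :: "(real ^ 'v::finite) set"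
  assumes h: "continuous_map (punctured_space k) (top_of_set S) h"
    and odd: "\<And>a. a \<in> topspace (punctured_space k) \<Longrightarrow> h (negate a) = - h a"
    and "k > 0"
  shows "genus S \<ge> enat k"
proof -
  have "(\<lambda>i. if i = 0 then 1 else 0) \<in> topspace (punctured_space k)"
    using \<open>k > 0\<close> by (auto simp: topspace_punctured_space)
  then have "h (\<lambda>i. if i = 0 then 1 else 0) \<in> S"
    using h by (auto simp: continuous_map_def Pi_iff) 
  then have "S \<noteq> {}" by blast
  have "enat k \<le> enat j" if g: "continuous_map (top_of_set S) (punctured_space j) g"
    "\<forall>f\<in>S. \<forall>i. g (- f) i = - g f i" for j g
  proof -
    have "k \<le> j"
    proof (rule Borsuk_Ulam)
      show "continuous_map (punctured_space k) (punctured_space j) (g \<circ> h)"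
        using h g(1) by (rule continuous_map_compose)
      fix x i assume x: "x \<in> topspace (punctured_space k)"
      then have "h x \<in> S"
        using h by (auto simp: continuous_map_def Pi_iff) 
      then show "(g \<circ> h) (negate x) i = - (g \<circ> h) x i"
        using g(2) odd[OF x] by simp
    qed
    then show ?thesis by simp
  qed
  then show ?thesis
    using \<open>S \<noteq> {}\<close> unfolding genus_def punctured_space_def by (auto intro!: INF_greatest)
qed

section \<open>The inequalities of Hoelder and Jensen\<close>

text \<open>
  Hoelder's inequality with weights \<open>c\<close> and exponents \<open>1 / \<alpha>\<close> and \<open>1 / (1 - \<alpha>)\<close>, obtained from Young's
  inequality after dividing by the two sums on the right. At the endpoint \<open>\<alpha> = 1\<close>, which is the case
  \<open>p = 1\<close> of the Cheeger inequality, the right-hand side is 0 if all \<open>b i\<close> are 0, and so is the left-hand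
  side, because \<open>0 powr 0 = 0\<close>.
\<close>

lemma holder_sum:
  fixes a b c :: "'i \<Rightarrow> real"
  assumes "finite I" and nn: "\<And>i. i \<in> I \<Longrightarrow> a i \<ge> 0" "\<And>i. i \<in> I \<Longrightarrow> b i \<ge> 0" "\<And>i. i \<in> I \<Longrightarrow> c i \<ge> 0"
    and \<alpha>: "0 \<le> \<alpha>" "\<alpha> \<le> 1"
  shows "(\<Sum>i\<in>I. c i * (a i powr \<alpha> * b i powr (1 - \<alpha>)))
       \<le> (\<Sum>i\<in>I. c i * a i) powr \<alpha> * (\<Sum>i\<in>I. c i * b i) powr (1 - \<alpha>)"
proof -
  let ?A = "\<Sum>i\<in>I. c i * a i" and ?B = "\<Sum>i\<in>I. c i * b i"
  have A0: "?A \<ge> 0" "?B \<ge> 0" using nn by (auto intro!: sum_nonneg)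
  show ?thesis
  proof (cases "?A = 0 \<or> ?B = 0")
    case True
    then have "c i * (a i powr \<alpha> * b i powr (1 - \<alpha>)) = 0" if "i \<in> I" for i
      using that nn \<open>finite I\<close> by (auto simp: sum_nonneg_eq_0_iff)
    then have "(\<Sum>i\<in>I. c i * (a i powr \<alpha> * b i powr (1 - \<alpha>))) = 0" by (rule sum.neutral[rule_format])
    then show ?thesis by simp
  next
    case False
    then have pos: "?A > 0" "?B > 0" using A0 by auto
    have young: "a i powr \<alpha> * b i powr (1 - \<alpha>)
        \<le> ?A powr \<alpha> * ?B powr (1 - \<alpha>) * (\<alpha> * (a i / ?A) + (1 - \<alpha>) * (b i / ?B))" if i: "i \<in> I" for i
    proof (cases "a i = 0 \<or> b i = 0")
      case True
      then show ?thesis using nn[OF i] pos \<alpha> by (auto intro!: mult_nonneg_nonneg add_nonneg_nonneg)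
    next
      case False
      then have "a i > 0" "b i > 0" using nn[OF i] by auto
      then have "(a i / ?A) powr \<alpha> * (b i / ?B) powr (1 - \<alpha>) \<le> \<alpha> * (a i / ?A) + (1 - \<alpha>) * (b i / ?B)"
        using \<alpha> pos by (intro Youngs_inequality_0) auto
      then have "?A powr \<alpha> * ?B powr (1 - \<alpha>) * ((a i / ?A) powr \<alpha> * (b i / ?B) powr (1 - \<alpha>))
          \<le> ?A powr \<alpha> * ?B powr (1 - \<alpha>) * (\<alpha> * (a i / ?A) + (1 - \<alpha>) * (b i / ?B))"
        by (intro mult_left_mono) auto
      also have "?A powr \<alpha> * ?B powr (1 - \<alpha>) * ((a i / ?A) powr \<alpha> * (b i / ?B) powr (1 - \<alpha>))
          = a i powr \<alpha> * b i powr (1 - \<alpha>)"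
        using nn[OF i] pos by (simp add: powr_divide)
      finally show ?thesis .
    qed
    have "(\<Sum>i\<in>I. c i * (a i powr \<alpha> * b i powr (1 - \<alpha>)))
       \<le> (\<Sum>i\<in>I. c i * (?A powr \<alpha> * ?B powr (1 - \<alpha>) * (\<alpha> * (a i / ?A) + (1 - \<alpha>) * (b i / ?B))))"
      by (intro sum_mono mult_left_mono young nn)
    also have "\<dots> = ?A powr \<alpha> * ?B powr (1 - \<alpha>) * (\<Sum>i\<in>I. \<alpha> * (c i * a i / ?A) + (1 - \<alpha>) * (c i * b i / ?B))"
      unfolding sum_distrib_left by (intro sum.cong) (auto simp: algebra_simps)
    also have "(\<Sum>i\<in>I. \<alpha> * (c i * a i / ?A) + (1 - \<alpha>) * (c i * b i / ?B)) = \<alpha> * (?A / ?A) + (1 - \<alpha>) * (?B / ?B)"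
      by (simp only: sum.distrib sum_divide_distrib[symmetric] sum_distrib_left[symmetric])
    also have "\<dots> = 1" using pos by simp
    finally show ?thesis by simp
  qed
qed

text \<open>
  Hoelder's inequality for two terms, in which the first factor is a \<open>p\<close>-th root and the second is 1.
\<close>

lemma powr_convex_combination:
  fixes s u p \<theta> :: real
  assumes p: "p \<ge> 1" and "s \<ge> 0" "u \<ge> 0" "0 \<le> \<theta>" "\<theta> \<le> 1"
  shows "((1 - \<theta>) * u + \<theta> * s) powr p \<le> (1 - \<theta>) * u powr p + \<theta> * s powr p"
proof -
  let ?c = "\<lambda>i::bool. if i then \<theta> else 1 - \<theta>" and ?a = "\<lambda>i::bool. (if i then s else u) powr p"
  have "(\<Sum>i\<in>UNIV. ?c i * (?a i powr (1 / p) * 1 powr (1 - 1 / p)))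
      \<le> (\<Sum>i\<in>UNIV. ?c i * ?a i) powr (1 / p) * (\<Sum>i\<in>UNIV. ?c i * 1) powr (1 - 1 / p)"
    using assms by (intro holder_sum) auto
  then have "(1 - \<theta>) * u + \<theta> * s \<le> ((1 - \<theta>) * u powr p + \<theta> * s powr p) powr (1 / p)"
    using assms by (simp add: UNIV_bool powr_powr add.commute)
  then have "((1 - \<theta>) * u + \<theta> * s) powr p \<le> (((1 - \<theta>) * u powr p + \<theta> * s powr p) powr (1 / p)) powr p"
    using assms by (intro powr_mono2) auto
  also have "\<dots> = (1 - \<theta>) * u powr p + \<theta> * s powr p"
    using assms by (simp add: powr_powr)
  finally show ?thesis .
qed

lemma powr_sum_le:
  fixes s t p :: real
  assumes "p \<ge> 1"
  shows "\<bar>s + t\<bar> powr p \<le> 2 powr (p - 1) * (\<bar>s\<bar> powr p + \<bar>t\<bar> powr p)"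
proof -
  let ?m = "(1 - 1 / 2) * \<bar>t\<bar> + 1 / 2 * \<bar>s\<bar>"
  have "\<bar>s + t\<bar> powr p \<le> (2 * ?m) powr p"
    using assms by (intro powr_mono2) auto
  also have "\<dots> = 2 powr p * ?m powr p" by (rule powr_mult)
  also have "\<dots> \<le> 2 powr p * ((1 - 1 / 2) * \<bar>t\<bar> powr p + 1 / 2 * \<bar>s\<bar> powr p)"
    using assms by (intro mult_left_mono powr_convex_combination) auto
  also have "\<dots> = 2 powr (p - 1) * (\<bar>s\<bar> powr p + \<bar>t\<bar> powr p)"
    by (simp add: powr_diff algebra_simps)
  finally show ?thesis .
qed

section \<open>Frustration and the Rayleigh quotient\<close>

lemma sum_sum_UNIV:
  fixes f :: "'v::finite \<Rightarrow> 'v \<Rightarrow> real"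
  shows "(\<Sum>x\<in>A. \<Sum>y\<in>B x. f x y) = (\<Sum>x\<in>UNIV. \<Sum>y\<in>UNIV. if x \<in> A \<and> y \<in> B x then f x y else 0)"
proof -
  have "(\<Sum>y\<in>UNIV. if x \<in> A \<and> y \<in> B x then f x y else 0) = (if x \<in> A then sum (f x) (B x) else 0)" for x
    by (auto simp: sum.If_cases)
  then show ?thesis by (simp add: sum.If_cases)
qed

lemma sum_neighbours_swap:
  fixes f :: "'v::finite \<Rightarrow> 'v \<Rightarrow> real"
  shows "(\<Sum>x\<in>UNIV. \<Sum>y\<in>neighbours E x. f x y) = (\<Sum>x\<in>UNIV. \<Sum>y\<in>neighbours E x. f y x)"
proof -
  have "(\<Sum>x\<in>UNIV. \<Sum>y\<in>neighbours E x. f x y) = (\<Sum>y\<in>UNIV. \<Sum>x | {x, y} \<in> E. f x y)"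
    using sum.swap_restrict[of UNIV UNIV f "\<lambda>x y. {x, y} \<in> E"] by (simp add: neighbours_def)
  moreover have "{x. {x, y} \<in> E} = neighbours E y" for y
    unfolding neighbours_def by (rule Collect_cong) (simp only: insert_commute[of _ y])
  ultimately show ?thesis by simp
qed

text \<open>
  The pair of disjoint sets \<open>A, B\<close> is encoded as a function with values in \<open>{1, -1, 0}\<close>.
\<close>

definition side :: "'v set \<Rightarrow> 'v set \<Rightarrow> 'v \<Rightarrow> real" where
  "side A B x = (if x \<in> A then 1 else if x \<in> B then -1 else 0)"

text \<open>
  An edge at \<open>x\<close> counts unless \<open>side A B\<close> is constant along it up to the signature. Summed over
  \<open>A \<union> B\<close> for disjoint \<open>A\<close> and \<open>B\<close> this gives the numerator of \<open>cheeger_beta\<close>, so that the four terms of that numerator need not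
  be treated separately.
\<close>

definition frustration ::
  "'v::finite set set \<Rightarrow> ('v set \<Rightarrow> real) \<Rightarrow> ('v set \<Rightarrow> real) \<Rightarrow> 'v set \<Rightarrow> 'v set \<Rightarrow> 'v \<Rightarrow> real" where
  "frustration E w \<sigma> A B x =
     (\<Sum>y\<in>neighbours E x. if side A B x = \<sigma> {x, y} * side A B y then 0 else w {x, y})"

context signed_graph
begin

lemma signature_neighbour: "y \<in> neighbours E x \<Longrightarrow> \<sigma> {x, y} = 1 \<or> \<sigma> {x, y} = -1"
  using signature[of "{x, y}"] by (auto simp: neighbours_def)

lemma weight_neighbour: "y \<in> neighbours E x \<Longrightarrow> w {x, y} > 0"
  using weight_pos[of "{x, y}"] by (auto simp: neighbours_def)

lemma signed_cut_commute: "signed_cut E w \<sigma> s A B = signed_cut E w \<sigma> s B A"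
proof -
  have "signed_cut E w \<sigma> s A B = (\<Sum>y\<in>B. \<Sum>x | x \<in> A \<and> {x, y} \<in> E \<and> \<sigma> {x, y} = s. w {x, y})"
    using sum.swap_restrict[of A B "\<lambda>x y. w {x, y}" "\<lambda>x y. {x, y} \<in> E \<and> \<sigma> {x, y} = s"]
    by (simp add: signed_cut_def neighbours_def)
  also have "\<dots> = signed_cut E w \<sigma> s B A"
    unfolding signed_cut_def neighbours_def mem_Collect_eq
    by (intro sum.cong Collect_cong refl) (simp_all only: insert_commute)
  finally show ?thesis .
qed

lemma cheeger_beta_frustration:
  assumes "A \<inter> B = {}"
  shows "cheeger_beta E w \<sigma> \<mu> A B = (\<Sum>x\<in>A \<union> B. frustration E w \<sigma> A B x) / (\<Sum>x\<in>A \<union> B. \<mu> x)"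
proof -
  have not_both: "\<not> (x \<in> A \<and> x \<in> B)" for x using assms by blast
  have "2 * signed_cut E w \<sigma> 1 A B + signed_cut E w \<sigma> (-1) A A + signed_cut E w \<sigma> (-1) B B
        + boundary_weight E w (A \<union> B)
      = signed_cut E w \<sigma> 1 A B + signed_cut E w \<sigma> 1 B A + signed_cut E w \<sigma> (-1) A A
        + signed_cut E w \<sigma> (-1) B B + boundary_weight E w (A \<union> B)"
    using signed_cut_commute[of 1 A B] by simp
  also have "\<dots> = (\<Sum>x\<in>A \<union> B. frustration E w \<sigma> A B x)"
    unfolding signed_cut_def boundary_weight_def frustration_def sum_sum_UNIV[where A=A] sum_sum_UNIV[where A=B]
      sum_sum_UNIV[where A="A \<union> B"] sum.distrib[symmetric]
  proof (intro sum.cong refl)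
    fix x y
    consider "y \<notin> neighbours E x" | "y \<in> neighbours E x" "\<sigma> {x, y} = 1" | "y \<in> neighbours E x" "\<sigma> {x, y} = -1"
      using signature_neighbour by blast
    then show "(if x \<in> A \<and> y \<in> {y \<in> B. y \<in> neighbours E x \<and> \<sigma> {x, y} = 1} then w {x, y} else 0)
        + (if x \<in> B \<and> y \<in> {y \<in> A. y \<in> neighbours E x \<and> \<sigma> {x, y} = 1} then w {x, y} else 0)
        + (if x \<in> A \<and> y \<in> {y \<in> A. y \<in> neighbours E x \<and> \<sigma> {x, y} = -1} then w {x, y} else 0)
        + (if x \<in> B \<and> y \<in> {y \<in> B. y \<in> neighbours E x \<and> \<sigma> {x, y} = -1} then w {x, y} else 0)
        + (if x \<in> A \<union> B \<and> y \<in> neighbours E x - (A \<union> B) then w {x, y} else 0)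
      = (if x \<in> A \<union> B \<and> y \<in> neighbours E x
           then if side A B x = \<sigma> {x, y} * side A B y then 0 else w {x, y} else 0)"
      using not_both[of x] not_both[of y]
      by cases (cases "x \<in> A"; cases "x \<in> B"; cases "y \<in> A"; cases "y \<in> B"; simp add: side_def)+
  qed
  finally show ?thesis unfolding cheeger_beta_def by (rule arg_cong)
qed

lemma frustration_nonneg: "frustration E w \<sigma> A B x \<ge> 0"
  unfolding frustration_def by (intro sum_nonneg) (auto intro: less_imp_le weight_neighbour)

lemma rayleigh_nonneg: "rayleigh E w \<sigma> \<mu> p f \<ge> 0"
  unfolding rayleigh_def
  by (intro divide_nonneg_nonneg mult_nonneg_nonneg sum_nonneg)
    (auto intro!: mult_nonneg_nonneg less_imp_le[OF weight_neighbour] less_imp_le[OF vertex_weight_pos])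

lemma compact_p_sphere:
  assumes "p \<ge> 1"
  shows "compact (p_sphere \<mu> p)"
proof -
  have "continuous_on UNIV (\<lambda>f. \<Sum>x\<in>UNIV. \<mu> x * \<bar>f $ x\<bar> powr p)"
    using assms by (intro continuous_on_sum continuous_on_mult continuous_on_const continuous_on_powr'
        continuous_on_rabs continuous_on_component continuous_on_id) auto
  then have "closed (p_sphere \<mu> p)"
    unfolding p_sphere_def by (rule closed_Collect_eq[OF _ continuous_on_const])
  moreover have "bounded (p_sphere \<mu> p)"
    unfolding bounded_iff
  proof (intro exI ballI)
    fix f assume f: "f \<in> p_sphere \<mu> p"
    have "\<bar>f $ x\<bar> \<le> (1 / \<mu> x) powr (1 / p)" for x
    proof -
      have "\<mu> x * \<bar>f $ x\<bar> powr p \<le> (\<Sum>x\<in>UNIV. \<mu> x * \<bar>f $ x\<bar> powr p)"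
        by (intro member_le_sum) (auto intro!: mult_nonneg_nonneg less_imp_le[OF vertex_weight_pos])
      then have "\<bar>f $ x\<bar> powr p \<le> 1 / \<mu> x"
        using f vertex_weight_pos[of x] by (simp add: p_sphere_def field_simps)
      then have "(\<bar>f $ x\<bar> powr p) powr (1 / p) \<le> (1 / \<mu> x) powr (1 / p)"
        using assms by (intro powr_mono2) auto
      then show ?thesis using assms by (simp add: powr_powr)
    qed
    then have "(\<Sum>x\<in>UNIV. \<bar>f $ x\<bar>) \<le> (\<Sum>x\<in>UNIV. (1 / \<mu> x) powr (1 / p))"
      by (intro sum_mono)
    then show "norm f \<le> (\<Sum>x\<in>UNIV. (1 / \<mu> x) powr (1 / p))"
      using norm_le_l1_cart[of f] by linarith
  qed
  ultimately show ?thesis by (simp add: compact_eq_bounded_closed)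
qed

lemma degree_le: "(\<Sum>y\<in>neighbours E x. w {x, y}) \<le> max_degree_ratio E w \<mu> * \<mu> x"
proof -
  have "(\<Sum>y\<in>neighbours E x. w {x, y}) / \<mu> x \<le> max_degree_ratio E w \<mu>"
    unfolding max_degree_ratio_def by (intro Max_ge) auto
  then show ?thesis using vertex_weight_pos[of x] by (simp add: field_simps)
qed

lemma sum_degree_powr_le:
  "(\<Sum>x\<in>UNIV. \<Sum>y\<in>neighbours E x. w {x, y} * \<bar>f $ x\<bar> powr p)
     \<le> max_degree_ratio E w \<mu> * (\<Sum>x\<in>UNIV. \<mu> x * \<bar>f $ x\<bar> powr p)"
  unfolding sum_distrib_left
proof (intro sum_mono)
  fix x
  have "(\<Sum>y\<in>neighbours E x. w {x, y} * \<bar>f $ x\<bar> powr p)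
      = (\<Sum>y\<in>neighbours E x. w {x, y}) * \<bar>f $ x\<bar> powr p"
    by (simp add: sum_distrib_right)
  also have "\<dots> \<le> (max_degree_ratio E w \<mu> * \<mu> x) * \<bar>f $ x\<bar> powr p"
    by (intro mult_right_mono degree_le) auto
  finally show "(\<Sum>y\<in>neighbours E x. w {x, y} * \<bar>f $ x\<bar> powr p)
      \<le> max_degree_ratio E w \<mu> * (\<mu> x * \<bar>f $ x\<bar> powr p)" by (simp add: mult.assoc)
qed

lemma edge_power_le:
  assumes "p \<ge> 1" "y \<in> neighbours E x"
  shows "\<bar>f $ x - \<sigma> {x, y} * f $ y\<bar> powr p \<le> 2 powr (p - 1) * (\<bar>f $ x\<bar> powr p + \<bar>f $ y\<bar> powr p)"
  using powr_sum_le[OF assms(1), of "f $ x" "- \<sigma> {x, y} * f $ y"] signature_neighbour[OF assms(2)]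
  by (elim disjE) simp_all

text \<open>
  On the sphere the Rayleigh quotients are bounded, so the suprema over members of the genus family
  are suprema of bounded sets.
\<close>

lemma rayleigh_le:
  assumes "p \<ge> 1" "f \<in> p_sphere \<mu> p"
  shows "rayleigh E w \<sigma> \<mu> p f \<le> 2 powr (p - 1) * max_degree_ratio E w \<mu>"
proof -
  let ?D = "\<Sum>x\<in>UNIV. \<Sum>y\<in>neighbours E x. w {x, y} * \<bar>f $ x\<bar> powr p"
  have "(\<Sum>x\<in>UNIV. \<Sum>y\<in>neighbours E x. w {x, y} * \<bar>f $ x - \<sigma> {x, y} * f $ y\<bar> powr p)
     \<le> (\<Sum>x\<in>UNIV. \<Sum>y\<in>neighbours E x.
          2 powr (p - 1) * (w {x, y} * \<bar>f $ x\<bar> powr p + w {y, x} * \<bar>f $ y\<bar> powr p))"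
  proof (intro sum_mono)
    fix x y assume y: "y \<in> neighbours E x"
    have "w {x, y} * \<bar>f $ x - \<sigma> {x, y} * f $ y\<bar> powr p
        \<le> w {x, y} * (2 powr (p - 1) * (\<bar>f $ x\<bar> powr p + \<bar>f $ y\<bar> powr p))"
      by (intro mult_left_mono edge_power_le assms y less_imp_le[OF weight_neighbour])
    then show "w {x, y} * \<bar>f $ x - \<sigma> {x, y} * f $ y\<bar> powr p
        \<le> 2 powr (p - 1) * (w {x, y} * \<bar>f $ x\<bar> powr p + w {y, x} * \<bar>f $ y\<bar> powr p)"
      by (simp add: insert_commute[of y x] algebra_simps)
  qed
  also have "\<dots> = 2 powr (p - 1) * (?D + (\<Sum>x\<in>UNIV. \<Sum>y\<in>neighbours E x. w {y, x} * \<bar>f $ y\<bar> powr p))"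
    by (simp only: sum_distrib_left[symmetric] sum.distrib)
  also have "(\<Sum>x\<in>UNIV. \<Sum>y\<in>neighbours E x. w {y, x} * \<bar>f $ y\<bar> powr p) = ?D"
    by (rule sum_neighbours_swap)
  also have "?D \<le> max_degree_ratio E w \<mu>"
    using sum_degree_powr_le[of f p] assms(2) by (simp add: p_sphere_def)
  finally show ?thesis
    using assms(2) by (simp add: rayleigh_def p_sphere_def)
qed

text \<open>
  Members of the family are nonempty because the empty set has genus 0; hence all the suprema are
  nonnegative and the infimum is taken over a set bounded below.
\<close>

lemma variational_eigenvalue_le:
  assumes "p \<ge> 1" "k \<ge> 1" and S: "S \<in> genus_family k (p_sphere \<mu> p)"
    and b: "\<And>f. f \<in> S \<Longrightarrow> rayleigh E w \<sigma> \<mu> p f \<le> b"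
  shows "variational_eigenvalue E w \<sigma> \<mu> p k \<le> b"
proof -
  have ne: "T \<noteq> {}" if "T \<in> genus_family k (p_sphere \<mu> p)" for T
  proof
    assume "T = {}"
    then have "genus T = 0" unfolding genus_def by (rule if_P)
    moreover have "enat k \<le> genus T" using that by (simp add: genus_family_def)
    ultimately show False using assms(2) by (simp add: enat_0_iff)
  qed
  have "0 \<le> (SUP f\<in>T. rayleigh E w \<sigma> \<mu> p f)" if T: "T \<in> genus_family k (p_sphere \<mu> p)" for T
  proof -
    obtain f where f: "f \<in> T" using ne[OF T] by blast
    have "bdd_above (rayleigh E w \<sigma> \<mu> p ` T)"
      using T by (intro bdd_aboveI2[where M="2 powr (p - 1) * max_degree_ratio E w \<mu>"]
          rayleigh_le[OF assms(1)]) (auto simp: genus_family_def)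
    then have "rayleigh E w \<sigma> \<mu> p f \<le> (SUP f\<in>T. rayleigh E w \<sigma> \<mu> p f)"
      using f by (rule cSUP_upper[rotated])
    then show ?thesis using rayleigh_nonneg[of p f] by linarith
  qed
  then have "bdd_below ((\<lambda>T. SUP f\<in>T. rayleigh E w \<sigma> \<mu> p f) ` genus_family k (p_sphere \<mu> p))"
    by (rule bdd_belowI2)
  moreover have "(SUP f\<in>S. rayleigh E w \<sigma> \<mu> p f) \<le> b"
    using ne[OF S] b by (rule cSUP_least)
  ultimately show ?thesis
    unfolding variational_eigenvalue_def by (rule cINF_lower2[OF _ S])
qed

end

section \<open>The upper bound\<close>

text \<open>
  For an admissible family this is the linear span of the \<open>k\<close> functions
  \<open>side (V (2 * i - 1)) (V (2 * i))\<close>, described by equations so that it is visibly closed: \<open>side\<close> has values \<open>\<plusminus>1\<close> on block \<open>i\<close>, so \<open>f\<close> is a multiple of it there iff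
  the product of the two is constant.
\<close>

definition block_functions :: "nat \<Rightarrow> (nat \<Rightarrow> 'v::finite set) \<Rightarrow> (real ^ 'v) set" where
  "block_functions k V =
     {f. (\<forall>x. (\<forall>i\<in>{1..k}. x \<notin> V (2 * i - 1) \<union> V (2 * i)) \<longrightarrow> f $ x = 0) \<and>
         (\<forall>i\<in>{1..k}. \<forall>x\<in>V (2 * i - 1) \<union> V (2 * i). \<forall>y\<in>V (2 * i - 1) \<union> V (2 * i).
            side (V (2 * i - 1)) (V (2 * i)) x * f $ x = side (V (2 * i - 1)) (V (2 * i)) y * f $ y)}"

lemma closed_Collect_ball:
  assumes "\<And>i. i \<in> I \<Longrightarrow> closed {f. P i f}"
  shows "closed {f. \<forall>i\<in>I. P i f}"
  unfolding Collect_ball_eq using assms by (intro closed_INT) auto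

lemma closed_block_functions:
  fixes V :: "nat \<Rightarrow> 'v::finite set"
  shows "closed (block_functions k V)"
proof -
  have eq: "closed {f :: real ^ 'v. a * f $ x = b * f $ y}" for a b x y
    by (intro closed_Collect_eq continuous_intros)
  have imp: "closed {f :: real ^ 'v. P \<longrightarrow> f $ x = 0}" for P x
    using eq[of 1 x 0 x] by (cases P) auto
  show ?thesis
    unfolding block_functions_def by (intro closed_Collect_conj closed_Collect_all closed_Collect_ball eq imp)
qed

lemma block_functions_scaleR:
  assumes "f \<in> block_functions k V"
  shows "c *\<^sub>R f \<in> block_functions k V"
proof -
  have scale: "b * (c *\<^sub>R f) $ x = c * (b * f $ x)" for b x by simp
  show ?thesis
    unfolding block_functions_def mem_Collect_eq scale
  proof (intro conjI allI impI ballI)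
    fix x assume "\<forall>i\<in>{1..k}. x \<notin> V (2 * i - 1) \<union> V (2 * i)"
    then have "f $ x = 0" using assms unfolding block_functions_def by blast
    then show "(c *\<^sub>R f) $ x = 0" by simp
  next
    fix i x y
    assume "i \<in> {1..k}" "x \<in> V (2 * i - 1) \<union> V (2 * i)" "y \<in> V (2 * i - 1) \<union> V (2 * i)"
    then have "side (V (2 * i - 1)) (V (2 * i)) x * f $ x = side (V (2 * i - 1)) (V (2 * i)) y * f $ y"
      using assms unfolding block_functions_def by blast
    then show "c * (side (V (2 * i - 1)) (V (2 * i)) x * f $ x) = c * (side (V (2 * i - 1)) (V (2 * i)) y * f $ y)"
      by (rule arg_cong)
  qed
qed

lemma continuous_map_punctured_space:
  "continuous_map (punctured_space k) (top_of_set S) h \<longleftrightarrow>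
     continuous_on (topspace (punctured_space k)) h \<and> h ` topspace (punctured_space k) \<subseteq> S"
proof -
  let ?X = "{x. (\<forall>i\<ge>k. x i = 0) \<and> (\<exists>i<k. x i \<noteq> 0)} :: (nat \<Rightarrow> real) set"
  have eq: "punctured_space k = top_of_set ?X"
    unfolding punctured_space_eq by (simp only: euclidean_product_topology)
  show ?thesis
    unfolding eq continuous_map_subtopology_eu image_subset_iff_funcset
    by (simp only: topspace_euclidean_subtopology)
qed

definition cheeger_max ::
  "'v::finite set set \<Rightarrow> ('v set \<Rightarrow> real) \<Rightarrow> ('v set \<Rightarrow> real) \<Rightarrow> ('v \<Rightarrow> real) \<Rightarrow> nat \<Rightarrow> (nat \<Rightarrow> 'v set) \<Rightarrow> real" where
  "cheeger_max E w \<sigma> \<mu> k V = Max ((\<lambda>i. cheeger_beta E w \<sigma> \<mu> (V (2 * i - 1)) (V (2 * i))) ` {1..k})"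

text \<open>
  There are infinitely many families \<open>V\<close>, as functions on all of \<open>nat\<close>, but the maximum is always a
  value of \<open>cheeger_beta\<close> at some pair of vertex sets.
\<close>

lemma finite_cheeger_max:
  assumes "k \<ge> 1"
  shows "finite {cheeger_max E w \<sigma> \<mu> k V | V. admissible_family k V}"
proof (rule finite_subset)
  show "{cheeger_max E w \<sigma> \<mu> k V | V. admissible_family k V} \<subseteq> range (\<lambda>(A, B). cheeger_beta E w \<sigma> \<mu> A B)"
  proof
    fix m assume "m \<in> {cheeger_max E w \<sigma> \<mu> k V | V. admissible_family k V}"
    then obtain V where V: "m = cheeger_max E w \<sigma> \<mu> k V" by blast
    have "cheeger_max E w \<sigma> \<mu> k V \<in> (\<lambda>i. cheeger_beta E w \<sigma> \<mu> (V (2 * i - 1)) (V (2 * i))) ` {1..k}"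
      unfolding cheeger_max_def using assms by (intro Max_in) auto
    then obtain i where "cheeger_max E w \<sigma> \<mu> k V = cheeger_beta E w \<sigma> \<mu> (V (2 * i - 1)) (V (2 * i))"
      by (rule imageE)
    then show "m \<in> range (\<lambda>(A, B). cheeger_beta E w \<sigma> \<mu> A B)"
      unfolding V by (intro range_eqI[of _ _ "(V (2 * i - 1), V (2 * i))"]) simp
  qed
qed simp

lemma cheeger_const_attained:
  fixes E :: "'v::finite set set"
  assumes "k \<ge> 1" "admissible_family k (V0 :: nat \<Rightarrow> 'v set)"
  obtains V where "admissible_family k V" "cheeger_const E w \<sigma> \<mu> k = cheeger_max E w \<sigma> \<mu> k V"
proof -
  have "cheeger_const E w \<sigma> \<mu> k \<in> {cheeger_max E w \<sigma> \<mu> k V | V. admissible_family k V}"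
    unfolding cheeger_const_def cheeger_max_def[symmetric]
    using assms by (intro Min_in finite_cheeger_max) auto
  then show ?thesis using that by blast
qed

lemma admissible_family_exists:
  assumes "k \<le> CARD('v::finite)"
  shows "\<exists>V :: nat \<Rightarrow> 'v set. admissible_family k V"
proof -
  obtain g :: "nat \<Rightarrow> 'v" where g: "inj_on g {0..<CARD('v)}"
    using ex_bij_betw_nat_finite[of "UNIV :: 'v set"] by (auto simp: bij_betw_def)
  define V where "V m = (if even m then {g (m div 2 - 1)} else {})" for m
  have V: "V (2 * i - 1) \<union> V (2 * i) = {g (i - 1)}" "V (2 * i - 1) \<inter> V (2 * i) = {}"
    if "i \<in> {1..k}" for i
    using that by (auto simp: V_def)
  have inj: "g (i - 1) \<noteq> g (j - 1)" if "i \<in> {1..k}" "j \<in> {1..k}" "i \<noteq> j" for i j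
    using that assms by (subst inj_on_eq_iff[OF g]) auto
  have "admissible_family k V"
    unfolding admissible_family_def
  proof (intro conjI ballI impI)
    fix i j assume ij: "i \<in> {1..k}" "j \<in> {1..k}" "i \<noteq> j"
    show "(V (2 * i - 1) \<union> V (2 * i)) \<inter> (V (2 * j - 1) \<union> V (2 * j)) = {}"
      unfolding V(1)[OF ij(1)] V(1)[OF ij(2)] using inj[OF ij] by blast
  next
    fix i assume i: "i \<in> {1..k}"
    show "V (2 * i - 1) \<inter> V (2 * i) = {}" "V (2 * i - 1) \<union> V (2 * i) \<noteq> {}"
      unfolding V[OF i] by simp_all
  qed
  then show ?thesis by blast
qed

context signed_graph
begin

text \<open>
  The energy \<open>\<bar>f x - \<sigma> f y\<bar>\<^sup>p\<close> of an edge vanishes if the edge is unfrustrated inside a block, and is at most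
  \<open>2\<^bsup>p-1\<^esup>(\<bar>f x\<bar>\<^sup>p + \<bar>f y\<bar>\<^sup>p)\<close> otherwise. As \<open>\<bar>f\<bar>\<close> is constant on each block, summing the second kind of
  edges over a block gives \<open>\<bar>f\<bar>\<^sup>p\<close> times the numerator of its \<open>cheeger_beta\<close>.
\<close>

lemma rayleigh_block_functions_le:
  assumes p: "p \<ge> 1" and V: "admissible_family k V"
    and h: "\<And>i. i \<in> {1..k} \<Longrightarrow> cheeger_beta E w \<sigma> \<mu> (V (2 * i - 1)) (V (2 * i)) \<le> h"
    and f: "f \<in> block_functions k V" "f \<in> p_sphere \<mu> p"
  shows "rayleigh E w \<sigma> \<mu> p f \<le> 2 powr (p - 1) * h"
proof -
  define U where "U i = V (2 * i - 1) \<union> V (2 * i)" for i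
  define spin where "spin i = side (V (2 * i - 1)) (V (2 * i))" for i
  define good where "good x y \<longleftrightarrow> (\<exists>i\<in>{1..k}. x \<in> U i \<and> y \<in> U i \<and> spin i x = \<sigma> {x, y} * spin i y)" for x y
  have "\<forall>i\<in>{1..k}. \<forall>j\<in>{1..k}. i \<noteq> j \<longrightarrow> U i \<inter> U j = {}"
    using V unfolding admissible_family_def U_def by (rule conjunct2)
  then have disj: "i = j" if "i \<in> {1..k}" "j \<in> {1..k}" "x \<in> U i" "x \<in> U j" for i j x
    using that by blast
  have "\<forall>i\<in>{1..k}. V (2 * i - 1) \<inter> V (2 * i) = {} \<and> U i \<noteq> {}"
    using V unfolding admissible_family_def U_def by (rule conjunct1)
  then have dj: "V (2 * i - 1) \<inter> V (2 * i) = {}" and ne: "\<exists>x. x \<in> U i" if "i \<in> {1..k}" for i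
    using that by blast+
  have "\<forall>x. (\<forall>i\<in>{1..k}. x \<notin> U i) \<longrightarrow> f $ x = 0"
    using f(1) unfolding block_functions_def U_def mem_Collect_eq by (rule conjunct1)
  then have zero: "f $ x = 0" if "\<And>i. i \<in> {1..k} \<Longrightarrow> x \<notin> U i" for x
    using that by blast
  have "\<forall>i\<in>{1..k}. \<forall>x\<in>U i. \<forall>y\<in>U i. spin i x * f $ x = spin i y * f $ y"
    using f(1) unfolding block_functions_def U_def spin_def mem_Collect_eq by (rule conjunct2)
  then have const: "spin i x * f $ x = spin i y * f $ y" if "i \<in> {1..k}" "x \<in> U i" "y \<in> U i" for i x y
    using that by blast
  have spin: "spin i x = 1 \<or> spin i x = -1" if "x \<in> U i" for i x
    using that by (auto simp: spin_def side_def U_def)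
  have spin0: "spin i x = 0" if "x \<notin> U i" for i x
    using that by (auto simp: spin_def side_def U_def)
  have good0: "f $ x - \<sigma> {x, y} * f $ y = 0"
    if xy: "good x y" and y: "y \<in> neighbours E x" for x y
  proof -
    obtain i where i: "i \<in> {1..k}" "x \<in> U i" "y \<in> U i" "spin i x = \<sigma> {x, y} * spin i y"
      using xy unfolding good_def by blast
    show ?thesis
      using const[OF i(1-3)] i(4) spin[OF i(2)] spin[OF i(3)] signature_neighbour[OF y] by auto
  qed
  have good_sym: "good x y = good y x" if "y \<in> neighbours E x" for x y
    using signature_neighbour[OF that] by (auto simp: good_def insert_commute)
  let ?D = "\<Sum>x\<in>UNIV. \<Sum>y\<in>neighbours E x. if good x y then 0 else w {x, y} * \<bar>f $ x\<bar> powr p"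
  have "(\<Sum>x\<in>UNIV. \<Sum>y\<in>neighbours E x. w {x, y} * \<bar>f $ x - \<sigma> {x, y} * f $ y\<bar> powr p)
     \<le> (\<Sum>x\<in>UNIV. \<Sum>y\<in>neighbours E x. 2 powr (p - 1) *
           ((if good x y then 0 else w {x, y} * \<bar>f $ x\<bar> powr p)
             + (if good y x then 0 else w {y, x} * \<bar>f $ y\<bar> powr p)))"
  proof (intro sum_mono)
    fix x y assume y: "y \<in> neighbours E x"
    show "w {x, y} * \<bar>f $ x - \<sigma> {x, y} * f $ y\<bar> powr p \<le> 2 powr (p - 1) *
           ((if good x y then 0 else w {x, y} * \<bar>f $ x\<bar> powr p)
             + (if good y x then 0 else w {y, x} * \<bar>f $ y\<bar> powr p))"
    proof (cases "good x y")
      case True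
      then show ?thesis using good0[OF True y] good_sym[OF y] by simp
    next
      case False
      have "w {x, y} * \<bar>f $ x - \<sigma> {x, y} * f $ y\<bar> powr p
          \<le> w {x, y} * (2 powr (p - 1) * (\<bar>f $ x\<bar> powr p + \<bar>f $ y\<bar> powr p))"
        by (intro mult_left_mono edge_power_le p y) (use weight_neighbour[OF y] in simp)
      then show ?thesis using False good_sym[OF y] by (simp add: algebra_simps insert_commute[of y x])
    qed
  qed
  also have "\<dots> = 2 powr (p - 1) *
      (?D + (\<Sum>x\<in>UNIV. \<Sum>y\<in>neighbours E x. if good y x then 0 else w {y, x} * \<bar>f $ y\<bar> powr p))"
    by (simp only: sum_distrib_left[symmetric] sum.distrib)
  also have "(\<Sum>x\<in>UNIV. \<Sum>y\<in>neighbours E x. if good y x then 0 else w {y, x} * \<bar>f $ y\<bar> powr p) = ?D"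
    by (rule sum_neighbours_swap)
  also have "?D \<le> h"
  proof -
    let ?U = "\<Union>i\<in>{1..k}. U i"
    have zero_U: "f $ x = 0" if "x \<notin> ?U" for x using that zero by blast
    let ?d = "\<lambda>x. \<Sum>y\<in>neighbours E x. if good x y then 0 else w {x, y} * \<bar>f $ x\<bar> powr p"
    have split: "(\<Sum>x\<in>?U. g x) = (\<Sum>i\<in>{1..k}. \<Sum>x\<in>U i. g x)" for g :: "'v \<Rightarrow> real"
      using disj by (intro sum.UNION_disjoint) auto
    have "?D = (\<Sum>x\<in>?U. ?d x)"
      by (intro sum.mono_neutral_right) (auto intro!: sum.neutral simp: zero_U simp del: UN_iff)
    also have "\<dots> = (\<Sum>i\<in>{1..k}. \<Sum>x\<in>U i. ?d x)" by (rule split)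
    also have "\<dots> \<le> (\<Sum>i\<in>{1..k}. \<Sum>x\<in>U i. h * (\<mu> x * \<bar>f $ x\<bar> powr p))"
    proof (rule sum_mono)
      fix i assume i: "i \<in> {1..k}"
      obtain x0 where x0: "x0 \<in> U i" using ne[OF i] ..
      have abs: "\<bar>f $ x\<bar> = \<bar>f $ x0\<bar>" if "x \<in> U i" for x
        using const[OF i that x0] spin[OF that] spin[OF x0] by auto
      have "?d x = \<bar>f $ x0\<bar> powr p * frustration E w \<sigma> (V (2 * i - 1)) (V (2 * i)) x" if x: "x \<in> U i" for x
      proof -
        have "good x y \<longleftrightarrow> spin i x = \<sigma> {x, y} * spin i y" for y
        proof
          assume "good x y"
          then obtain j where "j \<in> {1..k}" "x \<in> U j" "spin j x = \<sigma> {x, y} * spin j y" by (auto simp: good_def)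
          then show "spin i x = \<sigma> {x, y} * spin i y" using disj[OF i _ x] by metis
        next
          assume "spin i x = \<sigma> {x, y} * spin i y"
          moreover from this have "y \<in> U i" using spin[OF x] spin0[of y i] by (cases "y \<in> U i") auto
          ultimately show "good x y" using i x by (auto simp: good_def)
        qed
        then show ?thesis
          by (auto simp: frustration_def sum_distrib_left spin_def abs[OF x] intro!: sum.cong)
      qed
      then have "(\<Sum>x\<in>U i. ?d x) = \<bar>f $ x0\<bar> powr p * (\<Sum>x\<in>U i. frustration E w \<sigma> (V (2 * i - 1)) (V (2 * i)) x)"
        by (simp add: sum_distrib_left)
      also have "\<dots> \<le> \<bar>f $ x0\<bar> powr p * (h * (\<Sum>x\<in>U i. \<mu> x))"
      proof (intro mult_left_mono)
        have "(\<Sum>x\<in>U i. \<mu> x) > 0" using x0 vertex_weight_pos by (intro sum_pos) auto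
        then show "(\<Sum>x\<in>U i. frustration E w \<sigma> (V (2 * i - 1)) (V (2 * i)) x) \<le> h * (\<Sum>x\<in>U i. \<mu> x)"
          using h[OF i] unfolding cheeger_beta_frustration[OF dj[OF i]] U_def[symmetric]
          by (simp only: pos_divide_le_eq)
      qed auto
      also have "\<dots> = (\<Sum>x\<in>U i. h * (\<mu> x * \<bar>f $ x\<bar> powr p))"
        by (simp add: sum_distrib_left abs algebra_simps)
      finally show "(\<Sum>x\<in>U i. ?d x) \<le> (\<Sum>x\<in>U i. h * (\<mu> x * \<bar>f $ x\<bar> powr p))" .
    qed
    also have "\<dots> = (\<Sum>x\<in>?U. h * (\<mu> x * \<bar>f $ x\<bar> powr p))" by (rule split[symmetric])
    also have "\<dots> = (\<Sum>x\<in>UNIV. h * (\<mu> x * \<bar>f $ x\<bar> powr p))"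
      by (intro sum.mono_neutral_left) (auto simp: zero_U simp del: UN_iff)
    also have "\<dots> = h" using f(2) by (simp add: p_sphere_def sum_distrib_left[symmetric])
    finally show ?thesis .
  qed
  finally show ?thesis using f(2) by (simp add: rayleigh_def p_sphere_def)
qed

text \<open>
  The coefficients of a block function are coordinates on the span of the \<open>k\<close> functions; normalising
  gives an odd map from punctured \<open>k\<close>-space into the sphere, so the genus is at least \<open>k\<close>.
\<close>

lemma block_sphere_in_genus_family:
  assumes p: "p \<ge> 1" and k: "k \<ge> 1" and V: "admissible_family k V"
  shows "p_sphere \<mu> p \<inter> block_functions k V \<in> genus_family k (p_sphere \<mu> p)"
proof -
  let ?S = "p_sphere \<mu> p \<inter> block_functions k V"
  define U where "U i = V (2 * i - 1) \<union> V (2 * i)" for i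
  define spin where "spin i = side (V (2 * i - 1)) (V (2 * i))" for i
  have "\<forall>i\<in>{1..k}. \<forall>j\<in>{1..k}. i \<noteq> j \<longrightarrow> U i \<inter> U j = {}"
    using V unfolding admissible_family_def U_def by (rule conjunct2)
  then have disj: "i = j" if "i \<in> {1..k}" "j \<in> {1..k}" "x \<in> U i" "x \<in> U j" for i j x
    using that by blast
  have ne: "\<exists>x. x \<in> U i" if "i \<in> {1..k}" for i
    using V that unfolding admissible_family_def U_def by blast
  have spin: "spin i x = 1 \<or> spin i x = -1" if "x \<in> U i" for i x
    using that by (auto simp: spin_def side_def U_def)
  have spin0: "spin i x = 0" if "x \<notin> U i" for i x
    using that by (auto simp: spin_def side_def U_def)
  \<comment> \<open>Coordinates of Euclidean space are numbered from 0, blocks from 1.\<close>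
  define v :: "(nat \<Rightarrow> real) \<Rightarrow> real ^ 'v" where
    "v a = vec_lambda (\<lambda>x. \<Sum>i\<in>{1..k}. a (i - 1) * spin i x)" for a
  have v_on: "v a $ x = a (i - 1) * spin i x" if i: "i \<in> {1..k}" "x \<in> U i" for a i x
  proof -
    have "(\<Sum>j\<in>{1..k} - {i}. a (j - 1) * spin j x) = 0"
    proof (rule sum.neutral, rule ballI)
      fix j assume "j \<in> {1..k} - {i}"
      then have "x \<notin> U j" using disj[of i j x] i by blast
      then show "a (j - 1) * spin j x = 0" by (simp add: spin0)
    qed
    then show ?thesis
      unfolding v_def vec_lambda_beta sum.remove[OF finite_atLeastAtMost i(1)] by simp
  qed
  have v_off: "v a $ x = 0" if "\<And>i. i \<in> {1..k} \<Longrightarrow> x \<notin> U i" for a x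
    using that by (simp add: v_def spin0)
  have block: "v a \<in> block_functions k V" for a
  proof -
    have val: "spin i x * v a $ x = a (i - 1)" if "i \<in> {1..k}" "x \<in> U i" for i x
      using v_on[OF that, of a] spin[OF that(2)] by auto
    show ?thesis
      unfolding block_functions_def mem_Collect_eq U_def[symmetric] spin_def[symmetric]
    proof (intro conjI allI impI ballI)
      fix x assume "\<forall>i\<in>{1..k}. x \<notin> U i"
      then show "v a $ x = 0" by (intro v_off) blast
    qed (simp only: val)
  qed
  define N where "N a = (\<Sum>x\<in>UNIV. \<mu> x * \<bar>v a $ x\<bar> powr p)" for a
  have N_pos: "N a > 0" if a: "a \<in> topspace (punctured_space k)" for a
  proof -
    obtain i where i: "i < k" "a i \<noteq> 0" using a by (auto simp only: topspace_punctured_space mem_Collect_eq)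
    obtain x where x: "x \<in> U (Suc i)" using ne[of "Suc i"] i by auto
    have "v a $ x \<noteq> 0" using v_on[of "Suc i" x a] i x spin[OF x] by auto
    then have "0 < \<mu> x * \<bar>v a $ x\<bar> powr p" using vertex_weight_pos by simp
    also have "\<dots> \<le> N a"
      unfolding N_def
      by (intro member_le_sum) (auto intro!: mult_nonneg_nonneg less_imp_le[OF vertex_weight_pos])
    finally show ?thesis .
  qed
  define h where "h a = N a powr (- 1 / p) *\<^sub>R v a" for a
  have cont_v: "continuous_on A (\<lambda>a. v a $ x)" for A x
    unfolding v_def vec_lambda_beta
    by (intro continuous_on_sum continuous_on_mult continuous_on_const
        continuous_on_subset[OF continuous_on_product_coordinates]) auto
  then have "continuous_on A (\<lambda>a. \<chi> x. v a $ x)" for A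
    by (intro continuous_on_vec_lambda)
  then have cont_v': "continuous_on A v" for A by simp
  have "continuous_on A N" for A
    unfolding N_def using p
    by (intro continuous_on_sum continuous_on_mult continuous_on_const continuous_on_powr'
        continuous_on_rabs cont_v) auto
  moreover have "\<forall>a\<in>topspace (punctured_space k). N a \<noteq> 0"
    by (intro ballI) (rule less_imp_neq[OF N_pos, symmetric])
  ultimately have cont: "continuous_on (topspace (punctured_space k)) h"
    unfolding h_def by (intro continuous_on_scaleR continuous_on_powr cont_v' continuous_on_const)
  have "h a \<in> ?S" if a: "a \<in> topspace (punctured_space k)" for a
  proof -
    have "\<mu> x * \<bar>h a $ x\<bar> powr p = (1 / N a) * (\<mu> x * \<bar>v a $ x\<bar> powr p)" for x
      using N_pos[OF a] p by (simp add: h_def abs_mult powr_mult powr_powr powr_minus_divide powr_divide)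
    then have "(\<Sum>x\<in>UNIV. \<mu> x * \<bar>h a $ x\<bar> powr p) = (1 / N a) * N a"
      unfolding N_def by (simp only: sum_distrib_left[symmetric])
    then have "h a \<in> p_sphere \<mu> p" using N_pos[OF a] by (simp add: p_sphere_def)
    then show ?thesis using block by (simp add: h_def block_functions_scaleR)
  qed
  then have "h ` topspace (punctured_space k) \<subseteq> ?S" by (rule image_subsetI)
  with cont have cont_map: "continuous_map (punctured_space k) (top_of_set ?S) h"
    unfolding continuous_map_punctured_space by (rule conjI)
  have odd: "h (negate a) = - h a" for a
  proof -
    have "v (negate a) = - v a" by (simp add: v_def vec_eq_iff sum_negf)
    then show ?thesis by (simp add: h_def N_def)
  qed
  have genus: "enat k \<le> genus ?S"
    using k by (intro genus_ge[OF cont_map odd]) simp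
  have compact: "compact ?S"
    by (intro compact_Int_closed compact_p_sphere p closed_block_functions)
  have symmetric: "uminus ` ?S = ?S"
  proof -
    have minus: "- f \<in> ?S" if "f \<in> ?S" for f
      using that block_functions_scaleR[of f k V "-1"] by (simp add: p_sphere_def)
    show ?thesis
    proof (intro equalityI subsetI)
      fix f assume "f \<in> uminus ` ?S"
      then show "f \<in> ?S" using minus by (elim imageE) (simp only:)
    next
      fix f assume "f \<in> ?S"
      then show "f \<in> uminus ` ?S" by (rule image_eqI[of f uminus "- f", OF minus_minus[symmetric] minus])
    qed
  qed
  show ?thesis
    unfolding genus_family_def mem_Collect_eq by (intro conjI compact symmetric Int_lower1 genus)
qed

lemma variational_eigenvalue_le_cheeger_const:
  assumes p: "p \<ge> 1" and k: "k \<in> {1..CARD('v)}"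
  shows "variational_eigenvalue E w \<sigma> \<mu> p k \<le> 2 powr (p - 1) * cheeger_const E w \<sigma> \<mu> k"
proof -
  have k': "k \<ge> 1" "k \<le> CARD('v)" using k by auto
  obtain V0 :: "nat \<Rightarrow> 'v set" where V0: "admissible_family k V0"
    using admissible_family_exists[OF k'(2)] ..
  obtain V where V: "admissible_family k V" "cheeger_const E w \<sigma> \<mu> k = cheeger_max E w \<sigma> \<mu> k V"
    using cheeger_const_attained[OF k'(1) V0] .
  show ?thesis
  proof (rule variational_eigenvalue_le[OF p])
    show "p_sphere \<mu> p \<inter> block_functions k V \<in> genus_family k (p_sphere \<mu> p)"
      by (rule block_sphere_in_genus_family[OF p k'(1) V(1)])
    fix f assume "f \<in> p_sphere \<mu> p \<inter> block_functions k V"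
    then show "rayleigh E w \<sigma> \<mu> p f \<le> 2 powr (p - 1) * cheeger_const E w \<sigma> \<mu> k"
      unfolding V(2) by (intro rayleigh_block_functions_le[OF p V(1)]) (auto simp: cheeger_max_def)
  qed (rule k'(1))
qed

end

section \<open>Amghibech's inequality\<close>

text \<open>
  Both \<open>ln 2 \<le> 1\<close> and \<open>1 - 1 / p \<le> ln p\<close> are instances of \<open>ln x \<le> x - 1\<close>.
\<close>

lemma two_powr_le:
  fixes p :: real
  assumes "p \<ge> 1" shows "2 powr (1 - 1 / p) \<le> p"
proof -
  have "(1 - 1 / p) * ln 2 \<le> (1 - 1 / p) * 1"
    using assms ln_le_minus_one[of 2] by (intro mult_left_mono) auto
  also have "\<dots> \<le> ln p"
    using ln_le_minus_one[of "1 / p"] assms by (simp add: ln_div)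
  finally have "exp ((1 - 1 / p) * ln 2) \<le> exp (ln p)" by simp
  then show ?thesis using assms by (simp add: powr_def)
qed

lemma powr_add_le:
  fixes s u p :: real
  assumes "p \<ge> 1" "s \<ge> 0" "u \<ge> 0"
  shows "s powr p + u powr p \<le> (s + u) powr p"
proof (cases "s + u = 0")
  case True
  then have "s = 0" "u = 0" using assms by auto
  then show ?thesis by simp
next
  case False
  then have pos: "s + u > 0" using assms by linarith
  have le: "a powr p \<le> (s + u) powr p * (a / (s + u))" if "0 \<le> a" "a \<le> s + u" for a
  proof -
    have "(a / (s + u)) powr p \<le> (a / (s + u)) powr 1"
      using that pos assms by (intro powr_mono') auto
    then have "a powr p / (s + u) powr p \<le> a / (s + u)"
      using that pos by (simp add: powr_divide)
    moreover have "(s + u) powr p > 0" using pos by simp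
    ultimately show ?thesis by (simp only: pos_divide_le_eq mult.commute)
  qed
  have "s powr p + u powr p \<le> (s + u) powr p * (s / (s + u)) + (s + u) powr p * (u / (s + u))"
    using assms by (intro add_mono le) auto
  also have "\<dots> = (s + u) powr p" using pos by (simp flip: distrib_left add_divide_distrib)
  finally show ?thesis .
qed

text \<open>
  The version of Amghibech's inequality for values of opposite sign, where \<open>s + u\<close> is the distance of \<open>s\<close>
  and \<open>- u\<close>. It follows from superadditivity of the \<open>p\<close>-th power and \<open>2\<^bsup>1-1/p\<^esup> \<le> p\<close>.
\<close>

lemma powr_sum_le_mean_powr:
  fixes s u p :: real
  assumes p: "p \<ge> 1" and "s \<ge> 0" "u \<ge> 0"
  shows "s powr p + u powr p \<le> p * (s + u) * ((s powr p + u powr p) / 2) powr (1 - 1 / p)"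
proof -
  let ?X = "s powr p + u powr p"
  have X: "?X \<ge> 0" by simp
  have "?X powr (1 / p) \<le> ((s + u) powr p) powr (1 / p)"
    using powr_add_le[OF assms] p by (intro powr_mono2) auto
  also have "\<dots> = s + u" using assms by (simp add: powr_powr)
  finally have root: "?X powr (1 / p) \<le> s + u" .
  have "?X = ?X powr (1 / p) * ?X powr (1 - 1 / p)"
    using X by (cases "?X = 0") (auto simp: powr_add[symmetric])
  also have "\<dots> \<le> (s + u) * ?X powr (1 - 1 / p)"
    by (intro mult_right_mono root) auto
  also have "?X powr (1 - 1 / p) = 2 powr (1 - 1 / p) * (?X / 2) powr (1 - 1 / p)"
    using X by (simp add: powr_divide)
  also have "(s + u) * \<dots> \<le> (s + u) * (p * (?X / 2) powr (1 - 1 / p))"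
    using assms by (intro mult_left_mono mult_right_mono two_powr_le) auto
  finally show ?thesis by (simp add: mult_ac)
qed

lemma has_real_derivative_quadratic_minus_powr:
  fixes t :: real
  assumes "t > 0"
  shows "((\<lambda>t. k * (a * (t - u) + b * (t - u)\<^sup>2 / 2) + d * t - t powr p) has_real_derivative
           k * (a + b * (t - u)) + d - p * t powr (p - 1)) (at t)"
  using has_real_derivative_powr[OF assms, of p] assms
  by (auto intro!: derivative_eq_intros)

text \<open>
  Amghibech's inequality. Let \<open>N\<close> be the mean of \<open>s\<^sup>p\<close> and \<open>u\<^sup>p\<close> and \<open>c = N\<^bsup>1/p\<^esup>\<close>. For \<open>t\<close> between \<open>u\<close> and \<open>s\<close>,
  Young's inequality gives \<open>p t\<^bsup>p-1\<^esup> \<le> (p - 1) t\<^sup>p / c + c\<^bsup>p-1\<^esup>\<close>, and by convexity \<open>t\<^sup>p\<close> is at most the value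
  at \<open>t\<close> of the chord from \<open>(u, u\<^sup>p)\<close> to \<open>(s, s\<^sup>p)\<close>, whose integral over the interval is \<open>(s - u) N\<close>.
  Integrating bounds \<open>s\<^sup>p - u\<^sup>p\<close> by \<open>(s - u) ((p - 1) N / c + c\<^bsup>p-1\<^esup>) = p (s - u) c\<^bsup>p-1\<^esup>\<close>.
\<close>

lemma powr_diff_le_mean_powr:
  fixes s u p :: real
  assumes p: "p \<ge> 1" and u: "0 \<le> u" "u \<le> s"
  shows "s powr p - u powr p \<le> p * (s - u) * ((s powr p + u powr p) / 2) powr (1 - 1 / p)"
proof (cases "u = s")
  case False
  then have us: "u < s" "0 < s" using u by auto
  define N where "N = (s powr p + u powr p) / 2"
  define c where "c = N powr (1 / p)"
  have N: "N > 0" using us by (simp add: N_def add_pos_nonneg)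
  have c: "c > 0" "c powr p = N" using N p by (auto simp: c_def powr_powr)
  have c1: "c powr (p - 1) = N powr (1 - 1 / p)"
    using p by (simp add: c_def powr_powr field_simps)
  have Nc: "N / c = c powr (p - 1)"
    using c by (simp add: powr_diff)
  define slope where "slope = (s powr p - u powr p) / (s - u)"
  \<comment> \<open>An antiderivative of the difference between the bound and \<open>p t\<^bsup>p-1\<^esup>\<close>, so it increases on \<open>[u, s]\<close>.\<close>
  define G where "G t = (p - 1) / c * (u powr p * (t - u) + slope * (t - u)\<^sup>2 / 2) + c powr (p - 1) * t - t powr p" for t
  have "G u \<le> G s"
  proof (rule DERIV_nonneg_imp_increasing_open[where f = G])
    show "u \<le> s" using us by simp
    show "continuous_on {u..s} G"
      unfolding G_def using p u
      by (intro continuous_on_diff continuous_on_add continuous_on_mult continuous_on_divide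
          continuous_on_power continuous_on_powr' continuous_on_id continuous_on_const) auto
    fix t assume t: "u < t" "t < s"
    then have "t > 0" using u by simp
    have "(G has_real_derivative
        ((p - 1) / c * (u powr p + slope * (t - u)) + c powr (p - 1) - p * t powr (p - 1))) (at t)"
      unfolding G_def by (rule has_real_derivative_quadratic_minus_powr[OF \<open>t > 0\<close>])
    moreover have "p * t powr (p - 1) \<le> (p - 1) / c * (u powr p + slope * (t - u)) + c powr (p - 1)"
    proof -
      have "(t powr p) powr (1 - 1 / p) * (c powr p) powr (1 / p) \<le> (1 - 1 / p) * t powr p + 1 / p * c powr p"
        using \<open>t > 0\<close> c p by (intro Youngs_inequality_0) auto
      moreover have "(t powr p) powr (1 - 1 / p) = t powr (p - 1)"
      proof -
        have "p * (1 - 1 / p) = p - 1" using p by (simp add: field_simps)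
        then show ?thesis by (simp only: powr_powr)
      qed
      moreover have "(c powr p) powr (1 / p) = c" unfolding c(2) by (simp only: c_def)
      ultimately have "t powr (p - 1) * c \<le> (1 - 1 / p) * t powr p + 1 / p * c powr p" by simp
      then have "p * (t powr (p - 1) * c) \<le> p * ((1 - 1 / p) * t powr p + 1 / p * c powr p)"
        using p by (intro mult_left_mono) auto
      also have "\<dots> = (p - 1) * t powr p + c powr p"
        using p by (simp add: field_simps)
      finally have young: "p * t powr (p - 1) \<le> ((p - 1) * t powr p + c powr p) / c"
        using c by (simp add: field_simps)
      define \<theta> where "\<theta> = (t - u) / (s - u)"
      have "\<theta> * (s - u) = t - u" using us by (simp add: \<theta>_def)
      then have "(1 - \<theta>) * u + \<theta> * s = t" by (simp add: algebra_simps)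
      moreover have "0 \<le> \<theta>" "\<theta> \<le> 1" using t us by (auto simp: \<theta>_def)
      ultimately have \<theta>: "0 \<le> \<theta>" "\<theta> \<le> 1" "(1 - \<theta>) * u + \<theta> * s = t" by auto
      have slope: "slope * (t - u) = \<theta> * (s powr p - u powr p)"
        by (simp add: \<theta>_def slope_def)
      have "t powr p \<le> (1 - \<theta>) * u powr p + \<theta> * s powr p"
        using powr_convex_combination[OF p, of s u \<theta>] \<theta> u us by simp
      also have "\<dots> = u powr p + slope * (t - u)"
        unfolding slope by (simp add: algebra_simps)
      finally have "((p - 1) * t powr p + c powr p) / c \<le> ((p - 1) * (u powr p + slope * (t - u)) + c powr p) / c"
        using p c by (intro divide_right_mono add_right_mono mult_left_mono) auto
      also have "\<dots> = (p - 1) / c * (u powr p + slope * (t - u)) + c powr (p - 1)"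
        using c by (simp add: add_divide_distrib powr_diff)
      finally show ?thesis using young by linarith
    qed
    ultimately show "\<exists>y. (G has_real_derivative y) (at t) \<and> 0 \<le> y"
      by (intro exI conjI) auto
  qed
  then have "s powr p - u powr p
      \<le> (p - 1) / c * (u powr p * (s - u) + slope * (s - u)\<^sup>2 / 2) + c powr (p - 1) * (s - u)"
    by (simp add: G_def algebra_simps)
  also have "slope * (s - u)\<^sup>2 = (s powr p - u powr p) * (s - u)"
    using us by (simp add: slope_def power2_eq_square)
  also have "u powr p * (s - u) + (s powr p - u powr p) * (s - u) / 2 = (s - u) * N"
    by (simp add: N_def field_simps)
  also have "(p - 1) / c * ((s - u) * N) + c powr (p - 1) * (s - u) = p * (s - u) * (N / c)"
    unfolding Nc[symmetric] by (simp add: algebra_simps diff_divide_distrib)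
  finally show ?thesis unfolding Nc c1 by (simp add: N_def)
qed simp

text \<open>
  This is \<open>\<bar>\<psi> s - \<psi> u\<bar>\<close> for \<open>\<psi> t = sgn t * \<bar>t\<bar> powr p\<close>. It is written by cases because it arises as the
  integral, over all levels, of what an edge with end values \<open>s\<close> and \<open>u\<close> contributes to the frustration.
\<close>

definition layer_gap :: "real \<Rightarrow> real \<Rightarrow> real \<Rightarrow> real" where
  "layer_gap p s u =
     (if s * u > 0 then \<bar>\<bar>s\<bar> powr p - \<bar>u\<bar> powr p\<bar> else \<bar>s\<bar> powr p + \<bar>u\<bar> powr p)"

lemma layer_gap_le:
  assumes p: "p \<ge> 1"
  shows "layer_gap p s u \<le> p * \<bar>s - u\<bar> * ((\<bar>s\<bar> powr p + \<bar>u\<bar> powr p) / 2) powr (1 - 1 / p)"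
proof (cases "s * u > 0")
  case True
  then have diff: "\<bar>s - u\<bar> = \<bar>\<bar>s\<bar> - \<bar>u\<bar>\<bar>"
    by (auto simp: zero_less_mult_iff)
  show ?thesis
  proof (cases "\<bar>u\<bar> \<le> \<bar>s\<bar>")
    case le: True
    then have "\<bar>u\<bar> powr p \<le> \<bar>s\<bar> powr p" using p by (intro powr_mono2) auto
    then show ?thesis
      using powr_diff_le_mean_powr[OF p _ le] True le by (simp add: layer_gap_def diff)
  next
    case False
    then have le: "\<bar>s\<bar> \<le> \<bar>u\<bar>" by simp
    then have "\<bar>s\<bar> powr p \<le> \<bar>u\<bar> powr p" using p by (intro powr_mono2) auto
    then show ?thesis
      using powr_diff_le_mean_powr[OF p _ le] True le by (simp add: layer_gap_def diff add.commute)
  qed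
next
  case False
  then have "\<bar>s - u\<bar> = \<bar>s\<bar> + \<bar>u\<bar>"
    by (auto simp: zero_less_mult_iff not_less)
  then show ?thesis
    using powr_sum_le_mean_powr[OF p, of "\<bar>s\<bar>" "\<bar>u\<bar>"] False by (simp add: layer_gap_def)
qed

section \<open>The Cheeger inequality of a single function\<close>

lemma has_integral_superlevel:
  fixes a T :: real
  assumes "0 \<le> a" "a \<le> T"
  shows "((\<lambda>t. of_bool (t < a)) has_integral a) {0..T}"
proof -
  have "((\<lambda>t. 1 :: real) has_integral a) {0..a}"
    using has_integral_const_real[of "1 :: real" 0 a] assms by simp
  then have "((\<lambda>t. if t \<in> {0..a} then 1 :: real else 0) has_integral a) {0..T}"
    using assms by (subst has_integral_restrict) auto
  then show ?thesis
    by (rule has_integral_spike_finite[of "{a}", rotated 2]) auto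
qed

context signed_graph
begin

text \<open>
  For a level \<open>t\<close> let \<open>A\<close> and \<open>B\<close> be the sets where \<open>\<bar>g\<bar>\<^sup>p > t\<close> and \<open>g\<close> is positive, respectively negative.
  The lower bound \<open>K\<close> says that \<open>K\<close> times the volume of \<open>A \<union> B\<close> is at most the frustration of the pair.
  Integrated over \<open>t\<close>, the volume yields the \<open>p\<close>-th power of the norm of \<open>g\<close>. Seen from \<open>x\<close>, an edge is counted at the levels
  below \<open>\<bar>g x\<bar>\<^sup>p\<close>, except those below both powers if the edge respects the signs of \<open>g\<close>; the views
  from its two ends add up to the layer gap.
\<close>

lemma coarea_inequality:
  assumes p: "p \<ge> 1"
    and K: "\<And>A B. A \<inter> B = {} \<Longrightarrow> A \<union> B \<noteq> {} \<Longrightarrow> A \<union> B \<subseteq> {x. g $ x \<noteq> 0} \<Longrightarrow> K \<le> cheeger_beta E w \<sigma> \<mu> A B"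
  shows "K * (\<Sum>x\<in>UNIV. \<mu> x * \<bar>g $ x\<bar> powr p)
     \<le> 1 / 2 * (\<Sum>x\<in>UNIV. \<Sum>y\<in>neighbours E x. w {x, y} * layer_gap p (g $ x) (\<sigma> {x, y} * g $ y))"
proof -
  define a where "a x = \<bar>g $ x\<bar> powr p" for x
  define T where "T = (\<Sum>x\<in>UNIV. a x)"
  have a: "0 \<le> a x" "a x \<le> T" for x
    unfolding T_def by (auto simp: a_def intro!: member_le_sum)
  define same where "same x y \<longleftrightarrow> g $ x * (\<sigma> {x, y} * g $ y) > 0" for x y
  define J where "J x y t = of_bool (t < a x) - (if same x y then of_bool (t < min (a x) (a y)) else 0 :: real)" for x y t
  define j where "j x y = a x - (if same x y then min (a x) (a y) else 0)" for x y
  have "((\<lambda>t. K * (\<Sum>x\<in>UNIV. \<mu> x * of_bool (t < a x))) has_integral K * (\<Sum>x\<in>UNIV. \<mu> x * a x)) {0..T}"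
    by (intro has_integral_mult_right has_integral_sum has_integral_superlevel a) auto
  moreover have "(J x y has_integral j x y) {0..T}" for x y
  proof -
    have "((\<lambda>t. if same x y then of_bool (t < min (a x) (a y)) else 0 :: real) has_integral
        (if same x y then min (a x) (a y) else 0)) {0..T}"
      using a[of x] a[of y] by (cases "same x y") (auto intro!: has_integral_superlevel simp del: min_less_iff_conj)
    then show ?thesis
      unfolding J_def[abs_def] j_def by (intro has_integral_diff has_integral_superlevel a)
  qed
  then have "((\<lambda>t. \<Sum>x\<in>UNIV. \<Sum>y\<in>neighbours E x. w {x, y} * J x y t) has_integral
      (\<Sum>x\<in>UNIV. \<Sum>y\<in>neighbours E x. w {x, y} * j x y)) {0..T}"
    by (intro has_integral_sum has_integral_mult_right) auto
  moreover have "K * (\<Sum>x\<in>UNIV. \<mu> x * of_bool (t < a x)) \<le> (\<Sum>x\<in>UNIV. \<Sum>y\<in>neighbours E x. w {x, y} * J x y t)"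
    if t: "t \<in> {0..T}" for t
  proof -
    define A where "A = {x. g $ x > 0 \<and> t < a x}"
    define B where "B = {x. g $ x < 0 \<and> t < a x}"
    have AB: "A \<union> B = {x. t < a x}"
    proof -
      have "g $ x \<noteq> 0" if "t < a x" for x
        using that t by (auto simp: a_def)
      then show ?thesis unfolding A_def B_def by (auto simp: neq_iff)
    qed
    have dj: "A \<inter> B = {}" by (auto simp: A_def B_def)
    have vol: "(\<Sum>x\<in>UNIV. \<mu> x * of_bool (t < a x)) = (\<Sum>x\<in>A \<union> B. \<mu> x)"
      unfolding AB by (simp add: of_bool_def if_distrib[of "(*) _"] sum.If_cases)
    have "(\<Sum>x\<in>UNIV. \<Sum>y\<in>neighbours E x. w {x, y} * J x y t) = (\<Sum>x\<in>A \<union> B. \<Sum>y\<in>neighbours E x. w {x, y} * J x y t)"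
      by (intro sum.mono_neutral_right) (auto simp: AB J_def intro!: sum.neutral split: if_splits)
    also have "\<dots> = (\<Sum>x\<in>A \<union> B. frustration E w \<sigma> A B x)"
      unfolding frustration_def
    proof (intro sum.cong refl)
      fix x y assume x: "x \<in> A \<union> B" and y: "y \<in> neighbours E x"
      have "side A B x = \<sigma> {x, y} * side A B y \<longleftrightarrow> same x y \<and> t < a y"
        using signature_neighbour[OF y] x
        by (elim disjE) (auto simp: side_def same_def A_def B_def zero_less_mult_iff mult_less_0_iff)
      then show "w {x, y} * J x y t = (if side A B x = \<sigma> {x, y} * side A B y then 0 else w {x, y})"
        using x by (auto simp: J_def AB)
    qed
    finally have frust: "(\<Sum>x\<in>UNIV. \<Sum>y\<in>neighbours E x. w {x, y} * J x y t) = (\<Sum>x\<in>A \<union> B. frustration E w \<sigma> A B x)" .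
    show ?thesis
    proof (cases "A \<union> B = {}")
      case True
      then show ?thesis unfolding vol frust by simp
    next
      case False
      moreover have "A \<union> B \<subseteq> {x. g $ x \<noteq> 0}" by (auto simp: A_def B_def)
      ultimately have "K \<le> cheeger_beta E w \<sigma> \<mu> A B" by (intro K dj)
      moreover have "(\<Sum>x\<in>A \<union> B. \<mu> x) > 0"
        using False vertex_weight_pos by (intro sum_pos) auto
      ultimately show ?thesis
        unfolding vol frust cheeger_beta_frustration[OF dj] by (simp only: pos_le_divide_eq)
    qed
  qed
  ultimately have "K * (\<Sum>x\<in>UNIV. \<mu> x * a x) \<le> (\<Sum>x\<in>UNIV. \<Sum>y\<in>neighbours E x. w {x, y} * j x y)"
    by (rule has_integral_le)
  also have "\<dots> = 1 / 2 * ((\<Sum>x\<in>UNIV. \<Sum>y\<in>neighbours E x. w {x, y} * j x y)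
       + (\<Sum>x\<in>UNIV. \<Sum>y\<in>neighbours E x. w {y, x} * j y x))"
    using sum_neighbours_swap[of "\<lambda>x y. w {x, y} * j x y" E] by simp
  also have "\<dots> = 1 / 2 * (\<Sum>x\<in>UNIV. \<Sum>y\<in>neighbours E x. w {x, y} * j x y + w {y, x} * j y x)"
    by (simp only: sum.distrib)
  also have "(\<Sum>x\<in>UNIV. \<Sum>y\<in>neighbours E x. w {x, y} * j x y + w {y, x} * j y x)
      = (\<Sum>x\<in>UNIV. \<Sum>y\<in>neighbours E x. w {x, y} * layer_gap p (g $ x) (\<sigma> {x, y} * g $ y))"
  proof (intro sum.cong refl)
    fix x y assume y: "y \<in> neighbours E x"
    have c: "{y, x} = {x, y}" by (rule insert_commute)
    have "same y x = same x y" unfolding same_def c by (simp add: mult_ac)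
    moreover have "\<bar>\<sigma> {x, y} * g $ y\<bar> = \<bar>g $ y\<bar>" using signature_neighbour[OF y] by auto
    ultimately have "j x y + j y x = layer_gap p (g $ x) (\<sigma> {x, y} * g $ y)"
      unfolding layer_gap_def same_def[symmetric] by (auto simp: j_def a_def min_def)
    then show "w {x, y} * j x y + w {y, x} * j y x = w {x, y} * layer_gap p (g $ x) (\<sigma> {x, y} * g $ y)"
      unfolding c by (simp only: distrib_left[symmetric])
  qed
  finally show ?thesis by (simp add: a_def)
qed

text \<open>
  By the coarea inequality and Amghibech's inequality, \<open>K\<close> times the \<open>p\<close>-th power of the norm of
  \<open>g\<close> is at most a sum over edges to which Hoelder's inequality applies: one factor is the energy, the other the sum over edges
  of the mean of \<open>\<bar>g x\<bar>\<^sup>p\<close> and \<open>\<bar>g y\<bar>\<^sup>p\<close>, bounded through the maximal degree ratio.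
\<close>

lemma cheeger_inequality_of_energy:
  assumes p: "p \<ge> 1" and E: "E \<noteq> {}" and g: "g \<noteq> 0" and "K \<ge> 0"
    and K: "\<And>A B. A \<inter> B = {} \<Longrightarrow> A \<union> B \<noteq> {} \<Longrightarrow> A \<union> B \<subseteq> {x. g $ x \<noteq> 0} \<Longrightarrow> K \<le> cheeger_beta E w \<sigma> \<mu> A B"
    and energy: "1 / 2 * (\<Sum>x\<in>UNIV. \<Sum>y\<in>neighbours E x. w {x, y} * \<bar>g $ x - \<sigma> {x, y} * g $ y\<bar> powr p)
        \<le> lam * (\<Sum>x\<in>UNIV. \<mu> x * \<bar>g $ x\<bar> powr p)"
  shows "2 powr (p - 1) / (max_degree_ratio E w \<mu> powr (p - 1) * p powr p) * K powr p \<le> lam"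
proof -
  let ?M = "\<Sum>x\<in>UNIV. \<mu> x * \<bar>g $ x\<bar> powr p" and ?C = "max_degree_ratio E w \<mu>"
  let ?I = "Sigma UNIV (neighbours E)"
  let ?P = "\<lambda>(x, y). \<bar>g $ x - \<sigma> {x, y} * g $ y\<bar> powr p"
  let ?N = "\<lambda>(x, y). (\<bar>g $ x\<bar> powr p + \<bar>g $ y\<bar> powr p) / 2"
  let ?c = "\<lambda>(x, y). w {x, y} / 2"
  have sum_I: "(\<Sum>x\<in>UNIV. \<Sum>y\<in>neighbours E x. F x y) = (\<Sum>(x, y)\<in>?I. F x y)" for F :: "'v \<Rightarrow> 'v \<Rightarrow> real"
    by (subst sum.Sigma) auto
  obtain x0 where "g $ x0 \<noteq> 0" using g by (auto simp: vec_eq_iff)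
  then have "0 < \<mu> x0 * \<bar>g $ x0\<bar> powr p" using vertex_weight_pos by simp
  also have "\<dots> \<le> ?M"
    by (intro member_le_sum) (auto intro!: mult_nonneg_nonneg less_imp_le[OF vertex_weight_pos])
  finally have M: "?M > 0" .
  have w0: "w {x, y} \<ge> 0" if "y \<in> neighbours E x" for x y
    using weight_neighbour[OF that] by simp
  have C: "?C > 0"
  proof -
    obtain e where e: "e \<in> E" using E by blast
    then obtain x y where "e = {x, y}" using edge_card[OF e] by (auto simp: card_2_iff)
    then have y: "y \<in> neighbours E x" using e by (simp add: neighbours_def)
    have "0 < w {x, y}" by (rule weight_neighbour[OF y])
    also have "\<dots> \<le> (\<Sum>y\<in>neighbours E x. w {x, y})"
      using y w0 by (intro member_le_sum) auto
    also have "\<dots> \<le> ?C * \<mu> x" by (rule degree_le)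
    finally show ?thesis using vertex_weight_pos[of x] by (simp add: zero_less_mult_iff)
  qed
  have energy': "(\<Sum>i\<in>?I. ?c i * ?P i) \<le> lam * ?M"
  proof -
    have "(\<Sum>i\<in>?I. ?c i * ?P i) = 1 / 2 * (\<Sum>x\<in>UNIV. \<Sum>y\<in>neighbours E x. w {x, y} * \<bar>g $ x - \<sigma> {x, y} * g $ y\<bar> powr p)"
      unfolding sum_I sum_distrib_left by (intro sum.cong) auto
    then show ?thesis using energy by simp
  qed
  have mass: "(\<Sum>i\<in>?I. ?c i * ?N i) \<le> ?C * ?M / 2"
  proof -
    let ?D = "\<Sum>x\<in>UNIV. \<Sum>y\<in>neighbours E x. w {x, y} * \<bar>g $ x\<bar> powr p"
    have "(\<Sum>i\<in>?I. ?c i * ?N i)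
        = (\<Sum>x\<in>UNIV. \<Sum>y\<in>neighbours E x. 1 / 4 * (w {x, y} * \<bar>g $ x\<bar> powr p + w {y, x} * \<bar>g $ y\<bar> powr p))"
    proof -
      have "?c (x, y) * ?N (x, y) = 1 / 4 * (w {x, y} * \<bar>g $ x\<bar> powr p + w {y, x} * \<bar>g $ y\<bar> powr p)" for x y
        by (simp add: insert_commute[of y x] field_simps)
      then show ?thesis unfolding sum_I by (intro sum.cong) auto
    qed
    also have "\<dots> = 1 / 4 * (?D + (\<Sum>x\<in>UNIV. \<Sum>y\<in>neighbours E x. w {y, x} * \<bar>g $ y\<bar> powr p))"
      by (simp only: sum_distrib_left[symmetric] sum.distrib)
    also have "(\<Sum>x\<in>UNIV. \<Sum>y\<in>neighbours E x. w {y, x} * \<bar>g $ y\<bar> powr p) = ?D"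
      by (rule sum_neighbours_swap)
    finally show ?thesis using sum_degree_powr_le[of g p] by simp
  qed
  have nonneg: "0 \<le> (\<Sum>i\<in>?I. ?c i * ?P i)" "0 \<le> (\<Sum>i\<in>?I. ?c i * ?N i)"
    using w0 by (auto intro!: sum_nonneg)
  then have lam: "lam \<ge> 0" using energy' M by (smt (verit) mult_less_0_iff)
  have "K * ?M \<le> 1 / 2 * (\<Sum>x\<in>UNIV. \<Sum>y\<in>neighbours E x. w {x, y} * layer_gap p (g $ x) (\<sigma> {x, y} * g $ y))"
    by (rule coarea_inequality[OF p K])
  also have "\<dots> = (\<Sum>(x, y)\<in>?I. w {x, y} / 2 * layer_gap p (g $ x) (\<sigma> {x, y} * g $ y))"
    unfolding sum_I sum_distrib_left by (intro sum.cong) auto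
  also have "\<dots> \<le> (\<Sum>i\<in>?I. p * (?c i * (?P i powr (1 / p) * ?N i powr (1 - 1 / p))))"
  proof (rule sum_mono, clarify)
    fix x y assume y: "y \<in> neighbours E x"
    have "\<bar>\<sigma> {x, y} * g $ y\<bar> = \<bar>g $ y\<bar>" using signature_neighbour[OF y] by auto
    then have "layer_gap p (g $ x) (\<sigma> {x, y} * g $ y)
        \<le> p * (\<bar>g $ x - \<sigma> {x, y} * g $ y\<bar> * ((\<bar>g $ x\<bar> powr p + \<bar>g $ y\<bar> powr p) / 2) powr (1 - 1 / p))"
      using layer_gap_le[OF p, of "g $ x" "\<sigma> {x, y} * g $ y"] by (simp add: mult.assoc)
    then have "w {x, y} / 2 * layer_gap p (g $ x) (\<sigma> {x, y} * g $ y)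
        \<le> w {x, y} / 2 * (p * (\<bar>g $ x - \<sigma> {x, y} * g $ y\<bar> * ((\<bar>g $ x\<bar> powr p + \<bar>g $ y\<bar> powr p) / 2) powr (1 - 1 / p)))"
      using w0[OF y] by (intro mult_left_mono) auto
    then show "w {x, y} / 2 * layer_gap p (g $ x) (\<sigma> {x, y} * g $ y)
        \<le> p * (w {x, y} / 2 * ((\<bar>g $ x - \<sigma> {x, y} * g $ y\<bar> powr p) powr (1 / p)
             * ((\<bar>g $ x\<bar> powr p + \<bar>g $ y\<bar> powr p) / 2) powr (1 - 1 / p)))"
      using p by (simp add: powr_powr mult_ac)
  qed
  also have "\<dots> = p * (\<Sum>i\<in>?I. ?c i * (?P i powr (1 / p) * ?N i powr (1 - 1 / p)))"
    by (simp only: sum_distrib_left)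
  also have "\<dots> \<le> p * ((\<Sum>i\<in>?I. ?c i * ?P i) powr (1 / p) * (\<Sum>i\<in>?I. ?c i * ?N i) powr (1 - 1 / p))"
    using p w0 by (intro mult_left_mono holder_sum) auto
  also have "\<dots> \<le> p * ((lam * ?M) powr (1 / p) * (?C * ?M / 2) powr (1 - 1 / p))"
    using p by (intro mult_left_mono mult_mono powr_mono2 energy' mass nonneg) auto
  also have "\<dots> = p * (lam powr (1 / p) * (?C / 2) powr (1 - 1 / p)) * ?M"
  proof -
    have "(lam * ?M) powr (1 / p) * (?C * ?M / 2) powr (1 - 1 / p)
        = (lam powr (1 / p) * ?M powr (1 / p)) * ((?C / 2) powr (1 - 1 / p) * ?M powr (1 - 1 / p))"
      using lam M C powr_mult[of lam ?M "1 / p"] powr_mult[of "?C / 2" ?M "1 - 1 / p"] by simp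
    also have "\<dots> = (lam powr (1 / p) * (?C / 2) powr (1 - 1 / p)) * (?M powr (1 / p) * ?M powr (1 - 1 / p))"
      by (simp only: mult_ac)
    also have "?M powr (1 / p) * ?M powr (1 - 1 / p) = ?M"
      using M by (simp add: powr_add[symmetric])
    finally show ?thesis by simp
  qed
  finally have "K \<le> p * (lam powr (1 / p) * (?C / 2) powr (1 - 1 / p))"
    using M by (simp only: mult_le_cancel_right_pos)
  then have "K powr p \<le> (p * (lam powr (1 / p) * (?C / 2) powr (1 - 1 / p))) powr p"
    using \<open>K \<ge> 0\<close> p by (intro powr_mono2) auto
  also have "\<dots> = p powr p * (lam * (?C / 2) powr ((1 - 1 / p) * p))"
    using p lam C by (simp add: powr_mult powr_powr)
  also have "(1 - 1 / p) * p = p - 1" using p by (simp add: field_simps)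
  also have "(?C / 2) powr (p - 1) = ?C powr (p - 1) / 2 powr (p - 1)"
    using C by (simp add: powr_divide)
  finally have "K powr p \<le> p powr p * (lam * (?C powr (p - 1) / 2 powr (p - 1)))" .
  then have "2 powr (p - 1) / (?C powr (p - 1) * p powr p) * K powr p
      \<le> 2 powr (p - 1) / (?C powr (p - 1) * p powr p) * (p powr p * (lam * (?C powr (p - 1) / 2 powr (p - 1))))"
    by (intro mult_left_mono) auto
  also have "\<dots> = lam" using C p by simp
  finally show ?thesis .
qed

end

section \<open>Nodal domains and the lower bound\<close>

context signed_graph
begin

text \<open>
  Testing the eigenvalue equation with the restriction \<open>g\<close> of \<open>f\<close> to \<open>D\<close> gives \<open>lam\<close> times the
  \<open>p\<close>-th power of the norm of \<open>g\<close> on one side. On the other, edges inside \<open>D\<close> contribute their energy, and an edge leaving \<open>D\<close>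
  contributes at least \<open>\<bar>f x\<bar>\<^sup>p\<close>, its energy for \<open>g\<close>, because the signed value at its outer end does not
  have the sign of \<open>f x\<close>. The abstract flow \<open>z\<close> stands for \<open>Phi p\<close> of the signed differences if \<open>p > 1\<close> and
  for the selection from \<open>Sgn\<close> if \<open>p = 1\<close>.
\<close>

lemma signed_difference_energy_le:
  fixes f :: "real ^ 'v" and z :: "'v \<Rightarrow> 'v \<Rightarrow> real"
  assumes anti: "\<And>x y. y \<in> neighbours E x \<Longrightarrow> z y x = - \<sigma> {x, y} * z x y"
    and dual: "\<And>x y. y \<in> neighbours E x \<Longrightarrow> z x y * (f $ x - \<sigma> {x, y} * f $ y) = \<bar>f $ x - \<sigma> {x, y} * f $ y\<bar> powr p"
    and mono: "\<And>x y. y \<in> neighbours E x \<Longrightarrow> f $ x * (\<sigma> {x, y} * f $ y) \<le> 0 \<Longrightarrow> f $ x \<noteq> 0 \<Longrightarrow> \<bar>f $ x\<bar> powr p \<le> z x y * f $ x"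
    and eig: "\<And>x. (\<Sum>y\<in>neighbours E x. w {x, y} * z x y) * f $ x = lam * (\<mu> x * \<bar>f $ x\<bar> powr p)"
    and D: "D \<subseteq> {x. f $ x \<noteq> 0}" "\<And>x y. x \<in> D \<Longrightarrow> y \<in> neighbours E x \<Longrightarrow> y \<notin> D \<Longrightarrow> f $ x * (\<sigma> {x, y} * f $ y) \<le> 0"
    and g: "g = (\<chi> x. if x \<in> D then f $ x else 0)"
  shows "1 / 2 * (\<Sum>x\<in>UNIV. \<Sum>y\<in>neighbours E x. w {x, y} * \<bar>g $ x - \<sigma> {x, y} * g $ y\<bar> powr p)
        \<le> lam * (\<Sum>x\<in>UNIV. \<mu> x * \<bar>g $ x\<bar> powr p)"
proof -
  have gx: "g $ x = (if x \<in> D then f $ x else 0)" for x by (simp add: g)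
  have pt: "\<bar>g $ x - \<sigma> {x, y} * g $ y\<bar> powr p \<le> z x y * g $ x + z y x * g $ y"
    if y: "y \<in> neighbours E x" for x y
  proof -
    have c: "{y, x} = {x, y}" by (rule insert_commute)
    have x: "x \<in> neighbours E y" using y by (simp add: neighbours_def c)
    have abs: "\<bar>\<sigma> {x, y} * t\<bar> = \<bar>t\<bar>" for t using signature_neighbour[OF y] by auto
    consider "x \<in> D" "y \<in> D" | "x \<in> D" "y \<notin> D" | "x \<notin> D" "y \<in> D" | "x \<notin> D" "y \<notin> D" by blast
    then show ?thesis
    proof cases
      case 1
      then show ?thesis using dual[OF y] anti[OF y] by (simp add: gx algebra_simps)
    next
      case 2
      then show ?thesis using mono[OF y D(2)[OF 2(1) y 2(2)]] D(1) by (auto simp: gx)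
    next
      case 3
      then show ?thesis using mono[OF x D(2)[OF 3(2) x 3(1)]] D(1) abs[of "f $ y"] by (auto simp: gx)
    qed (simp add: gx)
  qed
  have "(\<Sum>x\<in>UNIV. \<Sum>y\<in>neighbours E x. w {x, y} * \<bar>g $ x - \<sigma> {x, y} * g $ y\<bar> powr p)
      \<le> (\<Sum>x\<in>UNIV. \<Sum>y\<in>neighbours E x. w {x, y} * z x y * g $ x + w {y, x} * z y x * g $ y)"
  proof (intro sum_mono)
    fix x y assume y: "y \<in> neighbours E x"
    have "w {x, y} * \<bar>g $ x - \<sigma> {x, y} * g $ y\<bar> powr p \<le> w {x, y} * (z x y * g $ x + z y x * g $ y)"
      using weight_neighbour[OF y] by (intro mult_left_mono pt y) auto
    then show "w {x, y} * \<bar>g $ x - \<sigma> {x, y} * g $ y\<bar> powr p \<le> w {x, y} * z x y * g $ x + w {y, x} * z y x * g $ y"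
      by (simp add: insert_commute[of y x] algebra_simps)
  qed
  also have "\<dots> = (\<Sum>x\<in>UNIV. \<Sum>y\<in>neighbours E x. w {x, y} * z x y * g $ x)
      + (\<Sum>x\<in>UNIV. \<Sum>y\<in>neighbours E x. w {y, x} * z y x * g $ y)"
    by (simp only: sum.distrib)
  also have "(\<Sum>x\<in>UNIV. \<Sum>y\<in>neighbours E x. w {y, x} * z y x * g $ y)
      = (\<Sum>x\<in>UNIV. \<Sum>y\<in>neighbours E x. w {x, y} * z x y * g $ x)"
    by (rule sum_neighbours_swap)
  also have "(\<Sum>x\<in>UNIV. \<Sum>y\<in>neighbours E x. w {x, y} * z x y * g $ x)
      = lam * (\<Sum>x\<in>UNIV. \<mu> x * \<bar>g $ x\<bar> powr p)"
    unfolding sum_distrib_left sum_distrib_right[symmetric]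
  proof (intro sum.cong refl)
    fix x
    show "(\<Sum>y\<in>neighbours E x. w {x, y} * z x y) * g $ x = lam * (\<mu> x * \<bar>g $ x\<bar> powr p)"
      using eig[of x] by (simp add: gx)
  qed
  finally show ?thesis by simp
qed

lemma Phi_times: "Phi p t * t = \<bar>t\<bar> powr p"
proof (cases "t = 0")
  case False
  then have "\<bar>t\<bar> powr p = \<bar>t\<bar> powr (p - 2) * \<bar>t\<bar> powr 2"
    unfolding powr_add[symmetric] by simp
  also have "\<bar>t\<bar> powr 2 = t * t" using False by (simp add: power2_eq_square flip: power2_abs)
  finally show ?thesis using False by (simp add: Phi_def)
qed (simp add: Phi_def)

lemma Phi_sign: "e = 1 \<or> e = -1 \<Longrightarrow> Phi p (e * t) = e * Phi p t"
  by (auto simp: Phi_def)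

lemma Phi_times_ge:
  assumes "p > 1" "a * b \<le> 0" "a \<noteq> 0"
  shows "\<bar>a\<bar> powr p \<le> Phi p (a - b) * a"
proof -
  have "0 < a \<and> b \<le> 0 \<or> a < 0 \<and> 0 \<le> b" using assms(2,3) by (auto simp: mult_le_0_iff)
  then have t: "a - b \<noteq> 0" "\<bar>a\<bar> \<le> \<bar>a - b\<bar>" "(a - b) * a = \<bar>a - b\<bar> * \<bar>a\<bar>"
    by (auto simp: abs_if algebra_simps)
  have pow: "\<bar>c\<bar> powr p = \<bar>c\<bar> powr (p - 1) * \<bar>c\<bar>" if "c \<noteq> 0" for c :: real
    using that by (simp add: powr_diff)
  have pow': "\<bar>c\<bar> powr (p - 2) * \<bar>c\<bar> = \<bar>c\<bar> powr (p - 1)" if "c \<noteq> 0" for c :: real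
  proof -
    have "\<bar>c\<bar> powr (p - 2) * \<bar>c\<bar> powr 1 = \<bar>c\<bar> powr (p - 1)"
      unfolding powr_add[symmetric] by simp
    then show ?thesis using that by simp
  qed
  have "\<bar>a\<bar> powr (p - 1) * \<bar>a\<bar> \<le> \<bar>a - b\<bar> powr (p - 1) * \<bar>a\<bar>"
    using assms(1) t by (intro mult_right_mono powr_mono2) auto
  also have "\<dots> = \<bar>a - b\<bar> powr (p - 2) * (\<bar>a - b\<bar> * \<bar>a\<bar>)"
    using pow'[OF t(1)] by (simp add: mult.assoc[symmetric])
  also have "\<dots> = Phi p (a - b) * a"
    using t(1) unfolding t(3)[symmetric] by (simp add: Phi_def)
  finally show ?thesis using pow[OF assms(3)] by simp
qed

text \<open>
  The two definitions of an eigenfunction, for \<open>p = 1\<close> and \<open>p > 1\<close>, enter the argument only through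
  these four properties of the flow \<open>z\<close> along the oriented edges.
\<close>

lemma eigenpair_flow:
  assumes "p \<ge> 1" and e: "is_eigenpair E w \<sigma> \<mu> p f lam"
  obtains z where "\<And>x y. y \<in> neighbours E x \<Longrightarrow> z y x = - \<sigma> {x, y} * z x y"
    and "\<And>x y. y \<in> neighbours E x \<Longrightarrow> z x y * (f $ x - \<sigma> {x, y} * f $ y) = \<bar>f $ x - \<sigma> {x, y} * f $ y\<bar> powr p"
    and "\<And>x y. y \<in> neighbours E x \<Longrightarrow> f $ x * (\<sigma> {x, y} * f $ y) \<le> 0 \<Longrightarrow> f $ x \<noteq> 0 \<Longrightarrow> \<bar>f $ x\<bar> powr p \<le> z x y * f $ x"
    and "\<And>x. (\<Sum>y\<in>neighbours E x. w {x, y} * z x y) * f $ x = lam * (\<mu> x * \<bar>f $ x\<bar> powr p)"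
proof (cases "p = 1")
  case True
  obtain z z' where zz: "\<forall>x. \<forall>y\<in>neighbours E x.
      z x y \<in> Sgn (f $ x - \<sigma> {x, y} * f $ y) \<and> z x y = - \<sigma> {x, y} * z y x"
    "\<forall>x. z' x \<in> Sgn (f $ x)"
    "\<forall>x. (\<Sum>y\<in>neighbours E x. w {x, y} * z x y) = lam * \<mu> x * z' x"
    using e True unfolding is_eigenpair_def by auto
  have z: "z x y \<in> Sgn (f $ x - \<sigma> {x, y} * f $ y)" "z x y = - \<sigma> {x, y} * z y x"
    if "y \<in> neighbours E x" for x y
    using zz(1) that by blast+
  have z': "z' x \<in> Sgn (f $ x)"
    and eq: "(\<Sum>y\<in>neighbours E x. w {x, y} * z x y) = lam * \<mu> x * z' x" for x
    using zz(2,3) by blast+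
  have Sgn: "c * t = \<bar>t\<bar>" if "c \<in> Sgn t" for c t
    using that by (auto simp: Sgn_def split: if_splits)
  show ?thesis
  proof (rule that[of z])
    fix x y assume y: "y \<in> neighbours E x"
    show "z y x = - \<sigma> {x, y} * z x y"
      using z(2)[OF y] signature_neighbour[OF y] by auto
    show "z x y * (f $ x - \<sigma> {x, y} * f $ y) = \<bar>f $ x - \<sigma> {x, y} * f $ y\<bar> powr p"
      using Sgn[OF z(1)[OF y]] True by simp
    assume "f $ x * (\<sigma> {x, y} * f $ y) \<le> 0" "f $ x \<noteq> 0"
    then have "0 < f $ x \<and> \<sigma> {x, y} * f $ y \<le> 0 \<or> f $ x < 0 \<and> 0 \<le> \<sigma> {x, y} * f $ y"
      by (auto simp: mult_le_0_iff)
    then show "\<bar>f $ x\<bar> powr p \<le> z x y * f $ x"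
      using z(1)[OF y] True by (auto simp: Sgn_def)
  next
    fix x
    show "(\<Sum>y\<in>neighbours E x. w {x, y} * z x y) * f $ x = lam * (\<mu> x * \<bar>f $ x\<bar> powr p)"
      using Sgn[OF z'[of x]] True by (simp add: eq mult.assoc)
  qed
next
  case False
  then have p: "p > 1" using assms(1) by simp
  have eq: "signed_p_laplacian E w \<sigma> p f x = lam * \<mu> x * Phi p (f $ x)" for x
    using e False by (simp add: is_eigenpair_def)
  show ?thesis
  proof (rule that[of "\<lambda>x y. Phi p (f $ x - \<sigma> {x, y} * f $ y)"])
    fix x y assume y: "y \<in> neighbours E x"
    have c: "{y, x} = {x, y}" by (rule insert_commute)
    have "f $ y - \<sigma> {x, y} * f $ x = - \<sigma> {x, y} * (f $ x - \<sigma> {x, y} * f $ y)"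
      using signature_neighbour[OF y] by auto
    then show "Phi p (f $ y - \<sigma> {y, x} * f $ x) = - \<sigma> {x, y} * Phi p (f $ x - \<sigma> {x, y} * f $ y)"
      unfolding c using Phi_sign[of "- \<sigma> {x, y}"] signature_neighbour[OF y] by (simp add: disj_commute)
    show "Phi p (f $ x - \<sigma> {x, y} * f $ y) * (f $ x - \<sigma> {x, y} * f $ y) = \<bar>f $ x - \<sigma> {x, y} * f $ y\<bar> powr p"
      by (rule Phi_times)
    assume "f $ x * (\<sigma> {x, y} * f $ y) \<le> 0" "f $ x \<noteq> 0"
    then show "\<bar>f $ x\<bar> powr p \<le> Phi p (f $ x - \<sigma> {x, y} * f $ y) * f $ x"
      by (rule Phi_times_ge[OF p])
  next
    fix x
    show "(\<Sum>y\<in>neighbours E x. w {x, y} * Phi p (f $ x - \<sigma> {x, y} * f $ y)) * f $ x = lam * (\<mu> x * \<bar>f $ x\<bar> powr p)"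
      using eq[of x] Phi_times[of p "f $ x"] by (simp add: signed_p_laplacian_def mult.assoc)
  qed
qed

definition nodal_step :: "real ^ 'v \<Rightarrow> ('v \<times> 'v) set" where
  "nodal_step f = {(x, y). {x, y} \<in> E \<and> f $ x * \<sigma> {x, y} * f $ y > 0}"

lemma strong_nodal_rel_eq:
  "strong_nodal_rel E \<sigma> f = {(x, y). f $ x \<noteq> 0 \<and> f $ y \<noteq> 0 \<and> (x, y) \<in> (nodal_step f)\<^sup>*}"
proof -
  have walk: "(hd xs, last xs) \<in> (nodal_step f)\<^sup>*" if "strong_nodal_walk E \<sigma> f xs" for xs
    using that
  proof (induction xs rule: rev_induct)
    case Nil
    then show ?case by (simp add: strong_nodal_walk_def)
  next
    case (snoc y xs)
    show ?case
    proof (cases "xs = []")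
      case False
      have step: "(last xs, y) \<in> nodal_step f"
        using snoc.prems[unfolded strong_nodal_walk_def, THEN conjunct2, rule_format, of "length xs - 1"] False
        by (simp add: nodal_step_def nth_append last_conv_nth)
      have "strong_nodal_walk E \<sigma> f xs"
        unfolding strong_nodal_walk_def
      proof (intro conjI allI impI False)
        fix i assume i: "Suc i < length xs"
        show "{xs ! i, xs ! Suc i} \<in> E" "f $ (xs ! i) * \<sigma> {xs ! i, xs ! Suc i} * f $ (xs ! Suc i) > 0"
          using snoc.prems[unfolded strong_nodal_walk_def, THEN conjunct2, rule_format, of i] i
          by (simp_all add: nth_append)
      qed
      then have "(hd xs, last xs) \<in> (nodal_step f)\<^sup>*" by (rule snoc.IH)
      then show ?thesis using step False by (simp add: rtrancl.rtrancl_into_rtrancl)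
    qed simp
  qed
  have conv: "\<exists>xs. strong_nodal_walk E \<sigma> f xs \<and> hd xs = x \<and> last xs = y" if "(x, y) \<in> (nodal_step f)\<^sup>*" for x y
    using that
  proof (induction rule: rtrancl_induct)
    case base
    have "strong_nodal_walk E \<sigma> f [x]" by (simp add: strong_nodal_walk_def)
    then show ?case by fastforce
  next
    case (step y z)
    then obtain xs where xs: "strong_nodal_walk E \<sigma> f xs" "hd xs = x" "last xs = y" by blast
    then have ne: "xs \<noteq> []" by (simp add: strong_nodal_walk_def)
    have "strong_nodal_walk E \<sigma> f (xs @ [z])"
      unfolding strong_nodal_walk_def
    proof (intro conjI allI impI)
      fix i assume i: "Suc i < length (xs @ [z])"
      have "{(xs @ [z]) ! i, (xs @ [z]) ! Suc i} \<in> E \<and>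
        f $ ((xs @ [z]) ! i) * \<sigma> {(xs @ [z]) ! i, (xs @ [z]) ! Suc i} * f $ ((xs @ [z]) ! Suc i) > 0"
      proof (cases "Suc i < length xs")
        case True
        then show ?thesis using xs(1) by (simp add: strong_nodal_walk_def nth_append)
      next
        case False
        then have i: "Suc i = length xs" using i by simp
        then have "xs ! i = y" using xs(3) ne by (simp add: last_conv_nth flip: i)
        then show ?thesis using step(2) i by (simp add: nth_append nodal_step_def)
      qed
      then show "{(xs @ [z]) ! i, (xs @ [z]) ! Suc i} \<in> E"
        "f $ ((xs @ [z]) ! i) * \<sigma> {(xs @ [z]) ! i, (xs @ [z]) ! Suc i} * f $ ((xs @ [z]) ! Suc i) > 0"
        by auto
    qed simp
    then show ?case using xs(2) ne by (intro exI[of _ "xs @ [z]"]) simp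
  qed
  show ?thesis
    unfolding strong_nodal_rel_def using walk conv by (auto intro: rtrancl_refl)
qed

lemma equiv_strong_nodal_rel: "equiv {x. f $ x \<noteq> 0} (strong_nodal_rel E \<sigma> f)"
proof -
  have "sym (nodal_step f)"
  proof (rule symI)
    fix x y assume "(x, y) \<in> nodal_step f"
    then show "(y, x) \<in> nodal_step f"
      by (simp add: nodal_step_def insert_commute[of y x] mult_ac)
  qed
  then have "sym ((nodal_step f)\<^sup>*)" by (rule sym_rtrancl)
  then show ?thesis
    unfolding strong_nodal_rel_eq
    by (intro equivI) (auto simp: refl_on_def sym_def trans_def intro: rtrancl_trans)
qed

text \<open>
  If the product were positive, the edge would be a nodal walk from \<open>x\<close> to \<open>y\<close>.
\<close>

lemma nodal_domain_boundary:
  assumes Q: "D \<in> {x. f $ x \<noteq> 0} // strong_nodal_rel E \<sigma> f"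
    and "x \<in> D" "y \<in> neighbours E x" "y \<notin> D"
  shows "f $ x * (\<sigma> {x, y} * f $ y) \<le> 0"
proof (rule ccontr)
  assume "\<not> ?thesis"
  then have pos: "f $ x * \<sigma> {x, y} * f $ y > 0" by (simp add: mult.assoc)
  then have "(x, y) \<in> nodal_step f" using assms(3) by (simp add: nodal_step_def neighbours_def)
  then have "(x, y) \<in> strong_nodal_rel E \<sigma> f" using pos by (auto simp: strong_nodal_rel_eq)
  moreover have "D = strong_nodal_rel E \<sigma> f `` {x}"
    using quotient_eq_iff equiv_class_eq_iff Q assms(2) equiv_strong_nodal_rel
    by (metis Image_singleton_iff equiv_class_eq quotientE)
  ultimately show False using assms(4) by auto
qed

text \<open>
  The pair with the least \<open>cheeger_beta\<close> among the subsets of the nodal domain: its value is a lower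
  bound \<open>K\<close> as required by the Cheeger inequality for the restriction of \<open>f\<close> to the domain.
\<close>

lemma cheeger_pair_in_nodal_domain:
  assumes p: "p \<ge> 1" and E: "E \<noteq> {}" and e: "is_eigenpair E w \<sigma> \<mu> p f lam"
    and Q: "D \<in> {x. f $ x \<noteq> 0} // strong_nodal_rel E \<sigma> f"
  shows "\<exists>A B. A \<inter> B = {} \<and> A \<union> B \<noteq> {} \<and> A \<union> B \<subseteq> D \<and>
     2 powr (p - 1) / (max_degree_ratio E w \<mu> powr (p - 1) * p powr p) * cheeger_beta E w \<sigma> \<mu> A B powr p \<le> lam"
proof -
  have D: "D \<subseteq> {x. f $ x \<noteq> 0}" "D \<noteq> {}"
    using Q equiv_strong_nodal_rel[of f] by (auto dest: in_quotient_imp_subset in_quotient_imp_non_empty)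
  define g where "g = (\<chi> x. if x \<in> D then f $ x else 0)"
  have supp: "{x. g $ x \<noteq> 0} = D" using D(1) by (auto simp: g_def)
  then have g0: "g \<noteq> 0" using D(2) by auto
  let ?S = "{(A, B). A \<inter> B = {} \<and> A \<union> B \<noteq> {} \<and> A \<union> B \<subseteq> D}"
  let ?\<beta> = "\<lambda>(A, B). cheeger_beta E w \<sigma> \<mu> A B"
  have "?S \<noteq> {}" using D(2) by auto
  then have "Min (?\<beta> ` ?S) \<in> ?\<beta> ` ?S" by (intro Min_in) auto
  then obtain A B where AB: "A \<inter> B = {}" "A \<union> B \<noteq> {}" "A \<union> B \<subseteq> D"
    and "Min (?\<beta> ` ?S) = cheeger_beta E w \<sigma> \<mu> A B" by auto
  then have least: "cheeger_beta E w \<sigma> \<mu> A B \<le> cheeger_beta E w \<sigma> \<mu> A' B'"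
    if "A' \<inter> B' = {}" "A' \<union> B' \<noteq> {}" "A' \<union> B' \<subseteq> D" for A' B'
    using that Min_le[of "?\<beta> ` ?S" "?\<beta> (A', B')"] by (auto simp del: Un_subset_iff)
  have nn: "cheeger_beta E w \<sigma> \<mu> A B \<ge> 0"
    unfolding cheeger_beta_frustration[OF AB(1)]
    by (intro divide_nonneg_nonneg sum_nonneg frustration_nonneg less_imp_le[OF vertex_weight_pos])
  have "1 / 2 * (\<Sum>x\<in>UNIV. \<Sum>y\<in>neighbours E x. w {x, y} * \<bar>g $ x - \<sigma> {x, y} * g $ y\<bar> powr p)
        \<le> lam * (\<Sum>x\<in>UNIV. \<mu> x * \<bar>g $ x\<bar> powr p)" (is ?energy)
  proof (rule eigenpair_flow[OF p e])
    fix z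
    assume "\<And>x y. y \<in> neighbours E x \<Longrightarrow> z y x = - \<sigma> {x, y} * z x y"
      "\<And>x y. y \<in> neighbours E x \<Longrightarrow> z x y * (f $ x - \<sigma> {x, y} * f $ y) = \<bar>f $ x - \<sigma> {x, y} * f $ y\<bar> powr p"
      "\<And>x y. y \<in> neighbours E x \<Longrightarrow> f $ x * (\<sigma> {x, y} * f $ y) \<le> 0 \<Longrightarrow> f $ x \<noteq> 0 \<Longrightarrow> \<bar>f $ x\<bar> powr p \<le> z x y * f $ x"
      "\<And>x. (\<Sum>y\<in>neighbours E x. w {x, y} * z x y) * f $ x = lam * (\<mu> x * \<bar>f $ x\<bar> powr p)"
    then show ?energy
      by (rule signed_difference_energy_le[OF _ _ _ _ D(1) nodal_domain_boundary[OF Q] g_def])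
  qed
  then have "2 powr (p - 1) / (max_degree_ratio E w \<mu> powr (p - 1) * p powr p) * cheeger_beta E w \<sigma> \<mu> A B powr p \<le> lam"
    by (intro cheeger_inequality_of_energy[OF p E g0 nn]) (auto simp only: supp intro: least)
  then show ?thesis using AB by blast
qed

text \<open>
  The pairs found in the nodal domains form an admissible family, because distinct domains are disjoint,
  and the worst of them bounds the Cheeger constant.
\<close>

lemma cheeger_const_le_eigenvalue:
  assumes p: "p \<ge> 1" and E: "E \<noteq> {}" and e: "is_eigenpair E w \<sigma> \<mu> p f lam"
  shows "2 powr (p - 1) / (max_degree_ratio E w \<mu> powr (p - 1) * p powr p)
      * cheeger_const E w \<sigma> \<mu> (num_strong_nodal_domains E \<sigma> f) powr p \<le> lam"
proof -
  let ?Q = "{x. f $ x \<noteq> 0} // strong_nodal_rel E \<sigma> f"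
  let ?m = "num_strong_nodal_domains E \<sigma> f"
  let ?c = "2 powr (p - 1) / (max_degree_ratio E w \<mu> powr (p - 1) * p powr p)"
  have finQ: "finite ?Q" by (rule finite_subset[OF subset_UNIV]) simp
  have "f \<noteq> 0" using e by (simp add: is_eigenpair_def)
  then obtain x where "f $ x \<noteq> 0" by (auto simp: vec_eq_iff)
  then have "?Q \<noteq> {}" by (auto simp: quotient_def)
  then have m: "?m \<ge> 1"
    using finQ by (simp add: num_strong_nodal_domains_def Suc_le_eq card_gt_0_iff)
  obtain dom where dom: "bij_betw dom {1..?m} ?Q"
    using ex_bij_betw_nat_finite_1[OF finQ] by (auto simp: num_strong_nodal_domains_def)
  have "\<exists>A B. A \<inter> B = {} \<and> A \<union> B \<noteq> {} \<and> A \<union> B \<subseteq> dom i \<and> ?c * cheeger_beta E w \<sigma> \<mu> A B powr p \<le> lam"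
    if "i \<in> {1..?m}" for i
    by (rule cheeger_pair_in_nodal_domain[OF p E e]) (use that dom in \<open>auto simp: bij_betw_def\<close>)
  then obtain A B where AB: "\<And>i. i \<in> {1..?m} \<Longrightarrow> A i \<inter> B i = {} \<and> A i \<union> B i \<noteq> {} \<and> A i \<union> B i \<subseteq> dom i
      \<and> ?c * cheeger_beta E w \<sigma> \<mu> (A i) (B i) powr p \<le> lam"
    by metis
  \<comment> \<open>Pair \<open>i\<close> sits at the positions \<open>2 * i - 1\<close> and \<open>2 * i\<close>.\<close>
  define V where "V n = (if even n then B (n div 2) else A ((n + 1) div 2))" for n
  have V: "V (2 * i - 1) = A i" "V (2 * i) = B i" if "i \<in> {1..?m}" for i
    using that by (auto simp: V_def)
  have disj: "dom i \<inter> dom j = {}" if "i \<in> {1..?m}" "j \<in> {1..?m}" "i \<noteq> j" for i j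
  proof -
    have "dom i \<in> ?Q" "dom j \<in> ?Q" using that(1,2) bij_betw_apply[OF dom] by blast+
    then have "dom i = dom j \<or> dom i \<inter> dom j = {}"
      by (rule quotient_disj[OF equiv_strong_nodal_rel])
    moreover have "dom i \<noteq> dom j"
      using that bij_betw_imp_inj_on[OF dom] by (meson inj_onD)
    ultimately show ?thesis by blast
  qed
  have adm: "admissible_family ?m V"
    unfolding admissible_family_def
  proof (intro conjI ballI impI)
    fix i j assume ij: "i \<in> {1..?m}" "j \<in> {1..?m}" "i \<noteq> j"
    show "(V (2 * i - 1) \<union> V (2 * i)) \<inter> (V (2 * j - 1) \<union> V (2 * j)) = {}"
      using AB[OF ij(1)] AB[OF ij(2)] disj[OF ij] unfolding V[OF ij(1)] V[OF ij(2)] by blast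
  next
    fix i assume i: "i \<in> {1..?m}"
    show "V (2 * i - 1) \<inter> V (2 * i) = {}" "V (2 * i - 1) \<union> V (2 * i) \<noteq> {}"
      using AB[OF i] unfolding V[OF i] by blast+
  qed
  obtain V' where V': "admissible_family ?m V'" "cheeger_const E w \<sigma> \<mu> ?m = cheeger_max E w \<sigma> \<mu> ?m V'"
    using cheeger_const_attained[OF m adm] .
  have "0 \<le> cheeger_beta E w \<sigma> \<mu> (V' (2 * 1 - 1)) (V' (2 * 1))"
  proof -
    have "V' (2 * 1 - 1) \<inter> V' (2 * 1) = {}" using V'(1) m unfolding admissible_family_def by (meson atLeastAtMost_iff order_refl)
    then show ?thesis
      by (subst cheeger_beta_frustration)
        (auto intro!: divide_nonneg_nonneg sum_nonneg frustration_nonneg less_imp_le[OF vertex_weight_pos])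
  qed
  also have "\<dots> \<le> cheeger_const E w \<sigma> \<mu> ?m"
    unfolding V'(2) cheeger_max_def using m by (intro Max_ge imageI) auto
  finally have nn: "0 \<le> cheeger_const E w \<sigma> \<mu> ?m" .
  have "cheeger_max E w \<sigma> \<mu> ?m V \<in> (\<lambda>i. cheeger_beta E w \<sigma> \<mu> (V (2 * i - 1)) (V (2 * i))) ` {1..?m}"
    unfolding cheeger_max_def using m by (intro Max_in) auto
  then obtain i where i: "i \<in> {1..?m}" "cheeger_max E w \<sigma> \<mu> ?m V = cheeger_beta E w \<sigma> \<mu> (A i) (B i)"
    using V by auto
  have "cheeger_const E w \<sigma> \<mu> ?m \<le> cheeger_max E w \<sigma> \<mu> ?m V"
    unfolding cheeger_const_def cheeger_max_def[symmetric]
    using finite_cheeger_max[OF m] adm by (intro Min_le) auto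
  then have "cheeger_const E w \<sigma> \<mu> ?m powr p \<le> cheeger_beta E w \<sigma> \<mu> (A i) (B i) powr p"
    using nn p unfolding i(2) by (intro powr_mono2) auto
  then have "?c * cheeger_const E w \<sigma> \<mu> ?m powr p \<le> ?c * cheeger_beta E w \<sigma> \<mu> (A i) (B i) powr p"
    by (intro mult_left_mono) auto
  also have "\<dots> \<le> lam" using AB[OF i(1)] by blast
  finally show ?thesis .
qed

end

theorem theorem8:
  fixes E :: "'v::finite set set"
    and w \<sigma> :: "'v set \<Rightarrow> real"
    and \<mu> :: "'v \<Rightarrow> real"
    and p :: real and k :: nat
  assumes "signed_graph E w \<sigma> \<mu>"
    and "E \<noteq> {}"
    and "p \<ge> 1"
    and "k \<in> {1..CARD('v)}"
  shows "(\<forall>f. is_eigenpair E w \<sigma> \<mu> p f (variational_eigenvalue E w \<sigma> \<mu> p k) \<longrightarrow>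
            2 powr (p - 1) / (max_degree_ratio E w \<mu> powr (p - 1) * p powr p)
              * cheeger_const E w \<sigma> \<mu> (num_strong_nodal_domains E \<sigma> f) powr p
            \<le> variational_eigenvalue E w \<sigma> \<mu> p k) \<and>
         variational_eigenvalue E w \<sigma> \<mu> p k \<le> 2 powr (p - 1) * cheeger_const E w \<sigma> \<mu> k"
proof -
  interpret signed_graph E w \<sigma> \<mu> by (rule assms(1))
  show ?thesis
    using cheeger_const_le_eigenvalue[OF assms(3,2)]
      variational_eigenvalue_le_cheeger_const[OF assms(3,4)] by blast
qed

end
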